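(* Let $n\ge2$, $\kappa=\frac{(n-1)(n+2)}2$, and consider the symmetric polynomials in $z,\bar z$ on $\mathbb{C}^n$ $$S(z)=\sum_{j=1}^nz_j,\qquad R(z)=\sum_{1\le j<k\le n}|z_j-z_k|^2=n\sum_{j=1}^n\Bigl|z_j-\frac{S(z)}n\Bigr|^2.$$ Then for every $a,b,m\in\mathbb{N}$, the symmetric polynomial $$P_{a,b,m}(z)=\mathrm{H}_{a,b}\bigl(S(z),\overline{S(z)}\bigr)\,L_m^{(\kappa-1)}\bigl(R(z)\bigr)$$ is an eigenfunction of $A_n$ in the sense that $$-A_nP_{a,b,m}=\lambda_{a,b,m}P_{a,b,m},\qquad \lambda_{a,b,m}=2\frac{\alpha_n}n(a+b+2m).$$ Moreover, the family $\{P_{a,b,m}:a,b,m\in\mathbb{N}\}$ is a basis of the polynomial algebra $\mathbb{C}[S,\overline S,R]$. In particular, this algebra is invariant under $A_n$ in the sense that $A_n(\mathbb{C}[S,\overline S,R])\subset\mathbb{C}[S,\overline S,R]$. Furthermore, the elements of the family are mutually orthogonal in $L^2(\mu_n)$.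
   Context: $\mathbb{N}=\{0,1,2,\ldots\}$; $\mathbb{C}^n\equiv\mathbb{R}^{2n}$; $\mathbb{C}^n_{\neq}=\{z\in\mathbb{C}^n:z_j\ne z_k\ \forall j\neq k\}$. $\mu_n$ is the probability measure $\mathrm{d}\mu_n(z)=\frac1{c_n}\mathrm{e}^{-n\sum_k|z_k|^2}\prod_{j<k}|z_j-z_k|^2\,\mathrm{d}z$ on $\mathbb{C}^n$ ($c_n$ normalizing constant). With $\alpha_n>0$ fixed, $\beta_n=n^2$ and $E_n(z)=\frac1n\sum_{k=1}^n|z_k|^2+\frac1{n^2}\sum_{j\ne k}\log\frac1{|z_j-z_k|}$, the differential operator $A_n$ is $A_nf=\alpha_n\bigl(\frac1{\beta_n}\Delta f-\nabla E_n\cdot\nabla f\bigr)$ for smooth $f$ on $\mathbb{C}^n_{\neq}$ (with the Euclidean Laplacian and gradient of $\mathbb{R}^{2n}$, and $A_nf=A_n\Re f+\mathrm{i}A_n\Im f$ for complex-valued $f$). With $\partial_s=\frac12(\partial_x-\mathrm{i}\partial_y)$, $\bar\partial_s=\frac12(\partial_x+\mathrm{i}\partial_y)$ for $s=x+\mathrm{i}y$, $\mathrm{H}_{a,b}$ is the normalized complex Hermite polynomial of bidegree $(a,b)$ for the complex Gaussian measure $\frac1\pi\mathrm{e}^{-|s|^2}\mathrm{d}s$ on $\mathbb{C}$: $\mathrm{H}_{a,b}(s,\overline s)=\frac{(-1)^{a+b}}{\sqrt{a!b!}}\mathrm{e}^{|s|^2}\bar\partial_s^a\partial_s^b\mathrm{e}^{-|s|^2}$.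 $L_m^{(\kappa-1)}$ is the classical generalized Laguerre polynomial of degree $m$ with parameter $\kappa-1$, i.e. the polynomial solution of $xy''+(\kappa-x)y'=-my$ normalized by $L_m^{(\alpha)}(0)=\binom{m+\alpha}{m}$ with $\alpha=\kappa-1$. *)

theory Defs
  imports
    "HOL-Analysis.Analysis"
    "HOL-Computational_Algebra.Polynomial"
    "HOL-Library.Function_Algebras"
begin

section \<open>Differential operators\<close>

definition dir_deriv :: "('a::real_normed_vector \<Rightarrow> 'b::real_normed_vector) \<Rightarrow> 'a \<Rightarrow> 'a \<Rightarrow> 'b" where
  "dir_deriv f v x = frechet_derivative f (at x) v"

definition gradient :: "('a::euclidean_space \<Rightarrow> real) \<Rightarrow> 'a \<Rightarrow> 'a" where
  "gradient f x = (\<Sum>b\<in>Basis. dir_deriv f b x *\<^sub>R b)"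

definition laplacian :: "('a::euclidean_space \<Rightarrow> real) \<Rightarrow> 'a \<Rightarrow> real" where
  "laplacian f x = (\<Sum>b\<in>Basis. dir_deriv (dir_deriv f b) b x)"

definition wirtinger :: "(complex \<Rightarrow> complex) \<Rightarrow> complex \<Rightarrow> complex" where
  "wirtinger f s = (dir_deriv f 1 s - \<i> * dir_deriv f \<i> s) / 2"

definition wirtinger_bar :: "(complex \<Rightarrow> complex) \<Rightarrow> complex \<Rightarrow> complex" where
  "wirtinger_bar f s = (dir_deriv f 1 s + \<i> * dir_deriv f \<i> s) / 2"


section \<open>The Ginibre gas and its generator\<close>

text \<open>
  \<open>\<complex>\<^sup>n\<close> is the type \<open>complex ^ 'n\<close> with \<open>n = CARD('n)\<close>. Its Euclidean structure (inner product,
  \<^const>\<open>Basis\<close>, \<^const>\<open>lborel\<close>) is the one of \<open>\<real>\<^sup>2\<^sup>n\<close>. The linear order on \<open>'n\<close> only serves to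
  index the pairs \<open>j < k\<close>.
\<close>

definition distinct_points :: "(complex ^ 'n::finite) set" where
  "distinct_points = {z. \<forall>j k. j \<noteq> k \<longrightarrow> z $ j \<noteq> z $ k}"

definition ginibre_weight :: "complex ^ 'n::{finite,linorder} \<Rightarrow> real" where
  "ginibre_weight z =
     exp (- real CARD('n) * (\<Sum>k\<in>UNIV. (cmod (z $ k))\<^sup>2)) *
     (\<Prod>(j,k)\<in>{(j,k). j < k}. (cmod (z $ j - z $ k))\<^sup>2)"

definition ginibre_measure :: "(complex ^ 'n::{finite,linorder}) measure" where
  "ginibre_measure =
     density lborel
       (\<lambda>z. ennreal (ginibre_weight z / (LINT w|lborel. ginibre_weight (w :: (complex, 'n) vec))))"

definition energy :: "complex ^ 'n::finite \<Rightarrow> real" where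
  "energy z =
     (\<Sum>k\<in>UNIV. (cmod (z $ k))\<^sup>2) / real CARD('n) +
     (\<Sum>(j,k)\<in>{(j,k). j \<noteq> k}. ln (1 / cmod (z $ j - z $ k))) / (real CARD('n))\<^sup>2"

definition generator_real ::
  "real \<Rightarrow> (complex ^ 'n::finite \<Rightarrow> real) \<Rightarrow> complex ^ 'n \<Rightarrow> real" where
  "generator_real \<alpha> f z =
     \<alpha> * (laplacian f z / (real CARD('n))\<^sup>2 - gradient energy z \<bullet> gradient f z)"

definition generator ::
  "real \<Rightarrow> (complex ^ 'n::finite \<Rightarrow> complex) \<Rightarrow> complex ^ 'n \<Rightarrow> complex" where
  "generator \<alpha> f z =
     complex_of_real (generator_real \<alpha> (\<lambda>w. Re (f w)) z) +
     \<i> * complex_of_real (generator_real \<alpha> (\<lambda>w. Im (f w)) z)"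


section \<open>Hermite and Laguerre polynomials\<close>

definition complex_hermite :: "nat \<Rightarrow> nat \<Rightarrow> complex \<Rightarrow> complex" where
  "complex_hermite a b s =
     (-1) ^ (a + b) / complex_of_real (sqrt (fact a * fact b)) *
     complex_of_real (exp ((cmod s)\<^sup>2)) *
     (wirtinger_bar ^^ a) ((wirtinger ^^ b) (\<lambda>w. complex_of_real (exp (- (cmod w)\<^sup>2)))) s"

definition is_laguerre :: "nat \<Rightarrow> real \<Rightarrow> real poly \<Rightarrow> bool" where
  "is_laguerre m \<alpha> p \<longleftrightarrow>
     degree p = m \<and>
     (\<forall>x. x * poly (pderiv (pderiv p)) x + (\<alpha> + 1 - x) * poly (pderiv p) x
            = - real m * poly p x) \<and>
     poly p 0 = (real m + \<alpha>) gchoose m"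

definition laguerre :: "nat \<Rightarrow> real \<Rightarrow> real poly" where
  "laguerre m \<alpha> = (THE p. is_laguerre m \<alpha> p)"

fun laguerre_coeff :: "nat \<Rightarrow> real \<Rightarrow> nat \<Rightarrow> real" where
  "laguerre_coeff m \<alpha> 0 = (real m + \<alpha>) gchoose m"
| "laguerre_coeff m \<alpha> (Suc k) =
     (real k - real m) * laguerre_coeff m \<alpha> k / ((real k + 1) * (real k + \<alpha> + 1))"

lemma laguerre_ode_iff_coeff:
  fixes p :: "real poly"
  shows "(\<forall>x. x * poly (pderiv (pderiv p)) x + (\<alpha> + 1 - x) * poly (pderiv p) x
              = - real m * poly p x) \<longleftrightarrow>
         (\<forall>k. (real k + 1) * (real k + \<alpha> + 1) * coeff p (Suc k)
              = (real k - real m) * coeff p k)"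
    (is "?ode \<longleftrightarrow> ?rec")
proof -
  define q where
    "q = pCons 0 (pderiv (pderiv p)) + smult (\<alpha> + 1) (pderiv p) - pCons 0 (pderiv p) + smult (real m) p"
  have "?ode \<longleftrightarrow> (\<forall>x. poly q x = poly 0 x)"
    by (simp add: q_def algebra_simps eq_neg_iff_add_eq_0)
  also have "\<dots> \<longleftrightarrow> q = 0"
    using poly_eq_poly_eq_iff[of q 0] by (metis ext)
  also have "\<dots> \<longleftrightarrow> (\<forall>k. coeff q k = 0)"
    by (simp add: poly_eq_iff)
  also have "\<dots> \<longleftrightarrow> ?rec"
  proof (intro iff_allI)
    fix k
    show "coeff q k = 0 \<longleftrightarrow>
      (real k + 1) * (real k + \<alpha> + 1) * coeff p (Suc k) = (real k - real m) * coeff p k"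
      by (cases k) (auto simp: q_def coeff_pderiv algebra_simps)
  qed
  finally show ?thesis .
qed

lemma ex1_is_laguerre:
  assumes "\<alpha> > -1"
  shows "\<exists>!p. is_laguerre m \<alpha> p"
proof (rule ex_ex1I)
  let ?c = "laguerre_coeff m \<alpha>"
  have pos: "(real m + \<alpha>) gchoose m > 0"
    using assms by (auto simp: gbinomial_prod_rev intro!: divide_pos_pos prod_pos)
  have nz: "?c k \<noteq> 0" if "k \<le> m" for k
    using that
  proof (induction k)
    case 0
    then show ?case using pos by simp
  next
    case (Suc k)
    then show ?case using assms by auto
  qed
  have z: "?c (Suc m + j) = 0" for j
    by (induction j) auto
  define p where "p = (\<Sum>k\<le>m. monom (?c k) k)"
  have coeff_p: "coeff p k = ?c k" for k
  proof (cases "k \<le> m")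
    case True
    then show ?thesis by (simp add: p_def coeff_sum if_distrib cong: if_cong)
  next
    case False
    then obtain j where "k = Suc m + j" by (metis less_imp_Suc_add add_Suc not_le)
    then show ?thesis using z[of j] False by (simp add: p_def coeff_sum)
  qed
  have "degree p = m"
  proof (rule antisym)
    show "degree p \<le> m"
      unfolding p_def by (intro degree_sum_le) (auto intro: order_trans[OF degree_monom_le])
    show "m \<le> degree p"
      using nz[of m] by (intro le_degree) (simp add: coeff_p)
  qed
  moreover have "poly p 0 = (real m + \<alpha>) gchoose m"
    by (simp add: poly_0_coeff_0 coeff_p)
  moreover have "(real k + 1) * (real k + \<alpha> + 1) * coeff p (Suc k) = (real k - real m) * coeff p k" for k
    using assms by (simp add: coeff_p)
  ultimately show "\<exists>p. is_laguerre m \<alpha> p"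
    unfolding is_laguerre_def laguerre_ode_iff_coeff by blast
next
  fix p q assume pq: "is_laguerre m \<alpha> p" "is_laguerre m \<alpha> q"
  have "coeff p k = coeff q k" for k
  proof (induction k)
    case 0
    then show ?case using pq by (simp add: is_laguerre_def poly_0_coeff_0)
  next
    case (Suc k)
    have "(real k + 1) * (real k + \<alpha> + 1) * coeff p (Suc k)
        = (real k + 1) * (real k + \<alpha> + 1) * coeff q (Suc k)"
      using pq Suc unfolding is_laguerre_def laguerre_ode_iff_coeff by simp
    moreover have "(real k + 1) * (real k + \<alpha> + 1) \<noteq> 0"
      using assms by simp
    ultimately show ?case by simp
  qed
  then show "p = q" by (simp add: poly_eq_iff)
qed

lemma is_laguerre_laguerre: "\<alpha> > -1 \<Longrightarrow> is_laguerre m \<alpha> (laguerre m \<alpha>)"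
  unfolding laguerre_def by (rule theI'[OF ex1_is_laguerre])


section \<open>Algebras of polynomial functions\<close>

text \<open>
  Polynomials in \<open>z\<close> and \<open>cnj z\<close> are identified with the functions they induce on \<open>\<complex>\<^sup>n\<close>. The
  vector space structure on functions is the pointwise one of
  \<^theory>\<open>HOL-Library.Function_Algebras\<close>.
\<close>

definition fun_scale :: "complex \<Rightarrow> ('a \<Rightarrow> complex) \<Rightarrow> 'a \<Rightarrow> complex" where
  "fun_scale c f = (\<lambda>x. c * f x)"

global_interpretation fun_space: vector_space fun_scale
  by standard (auto simp: fun_scale_def fun_eq_iff algebra_simps)

inductive_set generated_algebra :: "('a \<Rightarrow> complex) set \<Rightarrow> ('a \<Rightarrow> complex) set"
  for G :: "('a \<Rightarrow> complex) set" where
  gen: "f \<in> G \<Longrightarrow> f \<in> generated_algebra G"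
| const: "(\<lambda>x. c) \<in> generated_algebra G"
| add: "f \<in> generated_algebra G \<Longrightarrow> g \<in> generated_algebra G \<Longrightarrow>
    (\<lambda>x. f x + g x) \<in> generated_algebra G"
| mult: "f \<in> generated_algebra G \<Longrightarrow> g \<in> generated_algebra G \<Longrightarrow>
    (\<lambda>x. f x * g x) \<in> generated_algebra G"

definition symmetric_polynomials :: "(complex ^ 'n::finite \<Rightarrow> complex) set" where
  "symmetric_polynomials =
     {f \<in> generated_algebra (range (\<lambda>j z. z $ j) \<union> range (\<lambda>j z. cnj (z $ j))).
        \<forall>\<sigma>. bij \<sigma> \<longrightarrow> (\<forall>z. f (\<chi> j. z $ \<sigma> j) = f z)}"

definition S_poly :: "complex ^ 'n::finite \<Rightarrow> complex" where
  "S_poly z = (\<Sum>j\<in>UNIV. z $ j)"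

definition R_poly :: "complex ^ 'n::{finite,linorder} \<Rightarrow> real" where
  "R_poly z = (\<Sum>(j,k)\<in>{(j,k). j < k}. (cmod (z $ j - z $ k))\<^sup>2)"

definition SR_algebra :: "(complex ^ 'n::{finite,linorder} \<Rightarrow> complex) set" where
  "SR_algebra =
     generated_algebra {S_poly, \<lambda>z. cnj (S_poly z), \<lambda>z. complex_of_real (R_poly z)}"

definition kappa :: "nat \<Rightarrow> real" where
  "kappa n = (real n - 1) * (real n + 2) / 2"

definition P_poly ::
  "nat \<Rightarrow> nat \<Rightarrow> nat \<Rightarrow> complex ^ 'n::{finite,linorder} \<Rightarrow> complex" where
  "P_poly a b m z =
     complex_hermite a b (S_poly z) *
     complex_of_real (poly (laguerre m (kappa CARD('n) - 1)) (R_poly z))"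


section \<open>\<open>L\<^sup>2\<close>\<close>

definition square_integrable :: "'a measure \<Rightarrow> ('a \<Rightarrow> complex) \<Rightarrow> bool" where
  "square_integrable M f \<longleftrightarrow> f \<in> borel_measurable M \<and> integrable M (\<lambda>x. (cmod (f x))\<^sup>2)"

definition L2_inner :: "'a measure \<Rightarrow> ('a \<Rightarrow> complex) \<Rightarrow> ('a \<Rightarrow> complex) \<Rightarrow> complex" where
  "L2_inner M f g = (LINT x|M. f x * cnj (g x))"

end

theory Submission
  imports Defs "HOL-Probability.Distributions"
begin

text \<open>
  The functions \<open>S\<close>, \<open>cnj S\<close> and \<open>R\<close> reduce the generator to a second order operator in three
  variables, and this operator separates. Let \<open>X z = n z - S z (1, ..., 1)\<close> be the vector field
  \<open>centered\<close>; the gradient of \<open>R\<close> is \<open>2 X\<close>. The field \<open>X\<close> is orthogonal to all diagonal vectors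
  \<open>(c, ..., c)\<close>, so the gradients of \<open>S\<close> and \<open>R\<close> are orthogonal, while \<open>X \<bullet> X = n R\<close> and
  \<open>X \<bullet> z = R\<close>. The interaction \<open>\<Sum> ln (1 / \<bar>z\<^sub>j - z\<^sub>k\<bar>)\<close> is invariant under diagonal translations, and a
  dilation of the differences \<open>z\<^sub>j - z\<^sub>k\<close> changes it by an additive constant; hence its derivative is
  zero along diagonal vectors and constant along \<open>X\<close>, in spite of its singularities. Together this
  gives, for the generator \<open>A\<close> and \<open>f = h (S, cnj S) * g (R)\<close>,

    \<open>A f = (2 \<alpha> / n) ((2 \<partial>\<partial>' - s \<partial> - s' \<partial>') h) g + (4 \<alpha> / n) h (R g'' + (\<kappa> - R) g')\<close>,

  where \<open>s' = cnj s\<close> and \<open>\<partial>, \<partial>'\<close> are the Wirtinger derivatives. The first operator is diagonalised by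
  the complex Hermite polynomials and the second one is the Laguerre operator, so their products are
  eigenfunctions (\<open>generator_hermite_radial\<close>).

  The eigenvalue depends only on \<open>a + b + 2 m\<close>, so orthogonality cannot be read off from the spectrum
  alone. It comes from the two factors separately, by integration by parts against the unnormalised
  Ginibre weight, which is a polynomial times a Gaussian (\<open>gaussian_integration_by_parts\<close>). Along diagonal
  directions the Vandermonde factor is constant, and the resulting identity turns multiplication by \<open>S\<close>
  into differentiation: this lowers the Hermite indices until the integral vanishes (\<open>pairing_ladder\<close>,
  \<open>pairing_eq_0_hermite\<close>). Along \<open>X\<close> the Vandermonde factor is homogeneous, and the resulting identity
  says that the Laguerre operator is symmetric for functions of \<open>R\<close>, whatever polynomial in \<open>S\<close> and
  \<open>cnj S\<close> they are multiplied with (\<open>pairing_radial\<close>, \<open>pairing_eq_0_laguerre\<close>).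

  Orthogonality together with non-zero norms gives injectivity and linear independence. The span of the
  family contains all products of a Hermite polynomial in \<open>S\<close> and a polynomial in \<open>R\<close>, because the
  Laguerre polynomials have one element in each degree. By the three-term recursion of the Hermite
  polynomials these products are closed under multiplication by \<open>S\<close>, \<open>cnj S\<close> and \<open>R\<close>, so the span is the
  whole algebra (\<open>span_P_poly\<close>). Its invariance follows, as the family consists of eigenfunctions.
\<close>

section \<open>Ito--Hermite polynomials\<close>

text \<open>
  Ito's complex Hermite polynomials without normalisation, with \<open>s\<close> and \<open>cnj s\<close> replaced by independent
  variables \<open>x\<close> and \<open>y\<close>. Partial derivatives lower an index: \<open>\<partial>\<^sub>x\<close> gives \<open>a * ito (a - 1) b\<close> and \<open>\<partial>\<^sub>y\<close> gives
  \<open>b * ito a (b - 1)\<close>, so the recursion reads \<open>x H - \<partial>\<^sub>y H\<close>, the creation operator of the Gaussian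
  weight.
\<close>

fun ito :: "nat \<Rightarrow> nat \<Rightarrow> complex \<Rightarrow> complex \<Rightarrow> complex" where
  "ito 0 b x y = y ^ b"
| "ito (Suc a) b x y = x * ito a b x y - of_nat b * ito a (b - 1) x y"

text \<open>
  The defining recursion raises the first index; the polynomials are nevertheless symmetric under
  exchange of \<open>(a, x)\<close> and \<open>(b, y)\<close>, and this is the same recursion for the second index.
\<close>

lemma ito_Suc_right:
  "ito a (Suc b) x y = y * ito a b x y - of_nat a * ito (a - 1) b x y"
proof (induction a arbitrary: b)
  case 0
  then show ?case by simp
next
  case (Suc a)
  have left: "of_nat b * ito a b x y
      = of_nat b * (y * ito a (b - 1) x y - of_nat a * ito (a - 1) (b - 1) x y)"
    using Suc.IH[of "b - 1"] by (cases b) simp_all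
  have right: "of_nat a * ito a b x y
      = of_nat a * (x * ito (a - 1) b x y - of_nat b * ito (a - 1) (b - 1) x y)"
    by (cases a) simp_all
  have "ito (Suc a) (Suc b) x y - (y * ito (Suc a) b x y - of_nat (Suc a) * ito a b x y)
      = (of_nat a * ito a b x y
          - of_nat a * (x * ito (a - 1) b x y - of_nat b * ito (a - 1) (b - 1) x y))
      - (of_nat b * ito a b x y
          - of_nat b * (y * ito a (b - 1) x y - of_nat a * ito (a - 1) (b - 1) x y))"
    by (simp add: Suc.IH[of b] algebra_simps)
  also have "\<dots> = 0"
    by (simp only: left[symmetric] right[symmetric] diff_self)
  finally show ?case by (simp only: right_minus_eq diff_Suc_1)
qed

lemma ito_commute: "ito a b x y = ito b a y x"
proof (induction a arbitrary: b)
  case 0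
  show ?case by (induction b) simp_all
next
  case (Suc a)
  then show ?case by (simp add: ito_Suc_right)
qed

lemma cnj_ito: "cnj (ito a b x y) = ito a b (cnj x) (cnj y)"
  by (induction a b x y rule: ito.induct) simp_all

text \<open>
  The eigenvalue equation of the operator \<open>2 \<partial>\<^sub>x \<partial>\<^sub>y - x \<partial>\<^sub>x - y \<partial>\<^sub>y\<close>, with the derivatives written as lowered
  indices.
\<close>

lemma ito_eigen:
  "2 * of_nat a * of_nat b * ito (a - 1) (b - 1) x y
     - of_nat a * x * ito (a - 1) b x y - of_nat b * y * ito a (b - 1) x y
   = - (of_nat a + of_nat b) * ito a b x y"
proof -
  have "of_nat a * ito a b x y
      = of_nat a * (x * ito (a - 1) b x y - of_nat b * ito (a - 1) (b - 1) x y)"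
    by (cases a) simp_all
  moreover have "of_nat b * ito a b x y
      = of_nat b * (y * ito a (b - 1) x y - of_nat a * ito (a - 1) (b - 1) x y)"
    using ito_Suc_right[of a "b - 1" x y] by (cases b) simp_all
  ultimately show ?thesis by algebra
qed

lemma has_derivative_ito [derivative_intros]:
  fixes f g :: "'a::real_normed_vector \<Rightarrow> complex"
  assumes "(f has_derivative f') (at z within A)" "(g has_derivative g') (at z within A)"
  shows "((\<lambda>z. ito a b (f z) (g z)) has_derivative
    (\<lambda>v. of_nat a * ito (a - 1) b (f z) (g z) * f' v
       + of_nat b * ito a (b - 1) (f z) (g z) * g' v)) (at z within A)"
proof (induction a arbitrary: b)
  case 0
  show ?case
    by (auto intro!: derivative_eq_intros assms)
next
  case (Suc a)
  have rec: "of_nat a * ito a b (f z) (g z)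
      = of_nat a * (f z * ito (a - 1) b (f z) (g z) - of_nat b * ito (a - 1) (b - 1) (f z) (g z))"
    by (cases a) simp_all
  have "((\<lambda>z. ito (Suc a) b (f z) (g z)) has_derivative
      (\<lambda>v. f z * (of_nat a * ito (a - 1) b (f z) (g z) * f' v
              + of_nat b * ito a (b - 1) (f z) (g z) * g' v)
            + f' v * ito a b (f z) (g z)
            - of_nat b * (of_nat a * ito (a - 1) (b - 1) (f z) (g z) * f' v
              + of_nat (b - 1) * ito a (b - 1 - 1) (f z) (g z) * g' v))) (at z within A)"
    unfolding ito.simps
    by (intro has_derivative_diff has_derivative_mult has_derivative_mult_right Suc.IH assms)
  also have "(\<lambda>v. f z * (of_nat a * ito (a - 1) b (f z) (g z) * f' v
              + of_nat b * ito a (b - 1) (f z) (g z) * g' v)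
            + f' v * ito a b (f z) (g z)
            - of_nat b * (of_nat a * ito (a - 1) (b - 1) (f z) (g z) * f' v
              + of_nat (b - 1) * ito a (b - 1 - 1) (f z) (g z) * g' v))
     = (\<lambda>v. of_nat a * (f z * ito (a - 1) b (f z) (g z) - of_nat b * ito (a - 1) (b - 1) (f z) (g z)) * f' v
       + ito a b (f z) (g z) * f' v + of_nat b * ito (Suc a) (b - 1) (f z) (g z) * g' v)"
    by (simp add: algebra_simps)
  also note rec[symmetric]
  finally show ?case
    by (simp only: diff_Suc_1 of_nat_Suc distrib_right mult_1_left add.commute add.assoc)
qed

definition gauss :: "complex \<Rightarrow> complex" where
  "gauss w = complex_of_real (exp (- (cmod w)\<^sup>2))"

lemma has_derivative_gauss:
  "(gauss has_derivative (\<lambda>v. - (cnj s * v + s * cnj v) * gauss s)) (at s)"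
proof -
  have eq: "gauss = (\<lambda>w. exp (- (w * cnj w)))"
    by (rule ext) (simp add: gauss_def complex_mult_cnj exp_of_real flip: cmod_power2 of_real_power of_real_minus)
  show ?thesis
    unfolding eq
    by (rule has_derivative_eq_rhs[OF has_derivative_compose[OF _
            DERIV_exp[unfolded has_field_derivative_def]]])
      (auto intro!: derivative_eq_intros simp: algebra_simps fun_eq_iff)
qed

lemma dir_deriv_eqI: "(f has_derivative f') (at x) \<Longrightarrow> dir_deriv f v x = f' v"
  unfolding dir_deriv_def by (metis frechet_derivative_at)

text \<open>
  One step of the Rodrigues formula: differentiating the Gaussian contributes \<open>- cnj s\<close> or \<open>- s\<close>, which
  is the multiplication term of the two recursions.
\<close>

lemma wirtinger_ito_gauss:
  "wirtinger (\<lambda>s. ito a b s (cnj s) * gauss s) = (\<lambda>s. - (ito a (Suc b) s (cnj s) * gauss s))"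
  "wirtinger_bar (\<lambda>s. ito a b s (cnj s) * gauss s) = (\<lambda>s. - (ito (Suc a) b s (cnj s) * gauss s))"
proof -
  have *: "dir_deriv (\<lambda>s. ito a b s (cnj s) * gauss s) v s =
     (of_nat a * ito (a - 1) b s (cnj s) * v
       + of_nat b * ito a (b - 1) s (cnj s) * cnj v) * gauss s
     - ito a b s (cnj s) * (cnj s * v + s * cnj v) * gauss s" for v s
    by (rule dir_deriv_eqI) (auto intro!: derivative_eq_intros has_derivative_gauss simp: algebra_simps fun_eq_iff)
  show "wirtinger (\<lambda>s. ito a b s (cnj s) * gauss s) = (\<lambda>s. - (ito a (Suc b) s (cnj s) * gauss s))"
    by (rule ext) (simp only: wirtinger_def *, simp add: ito_Suc_right field_simps)
  show "wirtinger_bar (\<lambda>s. ito a b s (cnj s) * gauss s) = (\<lambda>s. - (ito (Suc a) b s (cnj s) * gauss s))"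
    by (rule ext) (simp only: wirtinger_bar_def *, simp add: field_simps)
qed

definition "hermite_const a b = 1 / complex_of_real (sqrt (fact a * fact b))"

lemma wirtinger_cmult:
  assumes "\<And>s. f differentiable (at s)"
  shows "wirtinger (\<lambda>s. c * f s) = (\<lambda>s. c * wirtinger f s)"
    "wirtinger_bar (\<lambda>s. c * f s) = (\<lambda>s. c * wirtinger_bar f s)"
proof -
  have "dir_deriv (\<lambda>s. c * f s) v s = c * dir_deriv f v s" for v s
    unfolding dir_deriv_def[of f]
    by (rule dir_deriv_eqI) (use assms in \<open>auto intro!: derivative_eq_intros simp: frechet_derivative_works\<close>)
  then show "wirtinger (\<lambda>s. c * f s) = (\<lambda>s. c * wirtinger f s)"
    "wirtinger_bar (\<lambda>s. c * f s) = (\<lambda>s. c * wirtinger_bar f s)"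
    by (auto simp: wirtinger_def wirtinger_bar_def fun_eq_iff algebra_simps)
qed

lemma complex_hermite_eq_ito:
  "complex_hermite a b s = hermite_const a b * ito a b s (cnj s)"
proof -
  have diff: "(\<lambda>s. ito a b s (cnj s) * gauss s) differentiable (at s)" for a b s
    unfolding differentiable_def
    by (auto intro!: exI derivative_eq_intros has_derivative_gauss)
  have 1: "(wirtinger ^^ b) (\<lambda>w. complex_of_real (exp (- (cmod w)\<^sup>2)))
      = (\<lambda>s. (-1) ^ b * (ito 0 b s (cnj s) * gauss s))"
  proof (induction b)
    case 0
    then show ?case by (simp add: gauss_def)
  next
    case (Suc b)
    show ?case
      unfolding funpow.simps o_def Suc.IH
      by (subst wirtinger_cmult(1)[OF diff]) (simp only: wirtinger_ito_gauss, simp)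
  qed
  have 2: "(wirtinger_bar ^^ a) (\<lambda>s. (-1) ^ b * (ito 0 b s (cnj s) * gauss s))
      = (\<lambda>s. (-1) ^ (a + b) * (ito a b s (cnj s) * gauss s))"
  proof (induction a)
    case 0
    then show ?case by simp
  next
    case (Suc a)
    show ?case
      unfolding funpow.simps o_def Suc.IH
      by (subst wirtinger_cmult(2)[OF diff]) (simp only: wirtinger_ito_gauss, simp)
  qed
  have 3: "complex_of_real (exp ((cmod s)\<^sup>2)) * gauss s = 1"
    by (simp add: gauss_def exp_minus flip: of_real_mult)
  have 4: "(-1) ^ (a + b) * (-1) ^ (a + b) = (1::complex)"
    by (metis power2_minus power_mult_distrib mult_minus1 minus_minus power_one)
  have "complex_hermite a b s = hermite_const a b * ((-1) ^ (a + b) * (-1) ^ (a + b)) * (complex_of_real (exp ((cmod s)\<^sup>2)) * gauss s)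
     * ito a b s (cnj s)"
    unfolding complex_hermite_def 1 2 hermite_const_def by (simp add: field_simps)
  then show ?thesis unfolding 3 4 by simp
qed

section \<open>Polynomial functions\<close>

lemma generated_algebra_cmult:
  "f \<in> generated_algebra G \<Longrightarrow> (\<lambda>x. c * f x) \<in> generated_algebra G"
  by (rule generated_algebra.mult[OF generated_algebra.const])

lemma generated_algebra_diff:
  assumes "f \<in> generated_algebra G" "g \<in> generated_algebra G"
  shows "(\<lambda>x. f x - g x) \<in> generated_algebra G"
  using generated_algebra.add[OF assms(1) generated_algebra_cmult[OF assms(2), of "-1"]] by simp

lemma generated_algebra_sum:
  "(\<And>i. i \<in> A \<Longrightarrow> f i \<in> generated_algebra G) \<Longrightarrow> (\<lambda>x. \<Sum>i\<in>A. f i x) \<in> generated_algebra G"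
  by (induction A rule: infinite_finite_induct) (simp_all add: generated_algebra.intros)

lemma generated_algebra_prod:
  "(\<And>i. i \<in> A \<Longrightarrow> f i \<in> generated_algebra G) \<Longrightarrow> (\<lambda>x. \<Prod>i\<in>A. f i x) \<in> generated_algebra G"
  by (induction A rule: infinite_finite_induct) (simp_all add: generated_algebra.intros)

lemma generated_algebra_power:
  "f \<in> generated_algebra G \<Longrightarrow> (\<lambda>x. f x ^ k) \<in> generated_algebra G"
  by (induction k) (simp_all add: generated_algebra.intros)

lemma generated_algebra_poly:
  assumes "(\<lambda>x. complex_of_real (r x)) \<in> generated_algebra G"
  shows "(\<lambda>x. complex_of_real (poly p (r x))) \<in> generated_algebra G"
  by (induction p) (simp_all add: assms generated_algebra.intros)

lemma generated_algebra_ito: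
  assumes "f \<in> generated_algebra G" "g \<in> generated_algebra G"
  shows "(\<lambda>x. ito a b (f x) (g x)) \<in> generated_algebra G"
proof (induction a arbitrary: b)
  case 0
  then show ?case using assms by (simp add: generated_algebra_power)
next
  case (Suc a)
  then show ?case using assms
    by (simp add: generated_algebra_diff generated_algebra.mult generated_algebra_cmult)
qed

lemmas generated_algebra_closure =
  generated_algebra.add generated_algebra.const generated_algebra.mult generated_algebra_diff
  generated_algebra_sum generated_algebra_prod generated_algebra_power generated_algebra_poly
  generated_algebra_ito

abbreviation polynomial_functions :: "(complex ^ 'n::finite \<Rightarrow> complex) set" where
  "polynomial_functions \<equiv> generated_algebra (range (\<lambda>j z. z $ j) \<union> range (\<lambda>j z. cnj (z $ j)))"

lemma coord_polynomial [simp]: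
  "(\<lambda>z. z $ j) \<in> polynomial_functions" "(\<lambda>z. cnj (z $ j)) \<in> polynomial_functions"
  by (auto intro!: generated_algebra.gen)

lemma cnj_polynomial_function:
  "f \<in> polynomial_functions \<Longrightarrow> (\<lambda>z. cnj (f z)) \<in> polynomial_functions"
proof (induction rule: generated_algebra.induct)
  case (gen f)
  then show ?case by (auto simp: coord_polynomial)
qed (simp_all add: generated_algebra.intros)

lemma dir_deriv_add:
  assumes "f differentiable (at z)" "g differentiable (at z)"
  shows "dir_deriv (\<lambda>x. f x + g x) v z = dir_deriv f v z + dir_deriv g v z"
  unfolding dir_deriv_def[of f] dir_deriv_def[of g]
  by (rule dir_deriv_eqI[OF has_derivative_add]) (use assms in \<open>simp_all only: frechet_derivative_works\<close>)

lemma dir_deriv_mult: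
  fixes f g :: "'a::real_normed_vector \<Rightarrow> 'b::real_normed_algebra"
  assumes "f differentiable (at z)" "g differentiable (at z)"
  shows "dir_deriv (\<lambda>x. f x * g x) v z = f z * dir_deriv g v z + dir_deriv f v z * g z"
  unfolding dir_deriv_def[of f] dir_deriv_def[of g]
  by (rule dir_deriv_eqI[OF has_derivative_mult]) (use assms in \<open>simp_all only: frechet_derivative_works\<close>)

lemma dir_deriv_bounded_linear_comp:
  assumes "bounded_linear h" "f differentiable (at z)"
  shows "dir_deriv (\<lambda>x. h (f x)) v z = h (dir_deriv f v z)"
  unfolding dir_deriv_def[of f]
  by (rule dir_deriv_eqI[OF bounded_linear.has_derivative])
    (use assms in \<open>simp_all only: frechet_derivative_works\<close>)

lemma sum_Basis_dir_deriv:
  fixes f :: "'a::euclidean_space \<Rightarrow> complex"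
  assumes "f differentiable (at z)"
  shows "(\<Sum>b\<in>Basis. of_real (u \<bullet> b) * dir_deriv f b z) = dir_deriv f u z"
proof -
  have lin: "linear (frechet_derivative f (at z))"
    by (rule has_derivative_linear[OF assms[unfolded frechet_derivative_works]])
  have "frechet_derivative f (at z) (\<Sum>b\<in>Basis. (u \<bullet> b) *\<^sub>R b) = (\<Sum>b\<in>Basis. of_real (u \<bullet> b) * dir_deriv f b z)"
    using lin by (simp add: linear_sum linear_scale dir_deriv_def scaleR_conv_of_real[where 'a = complex])
  then show ?thesis by (simp add: euclidean_representation dir_deriv_def)
qed

lemma has_derivative_coord: "((\<lambda>z. z $ j) has_derivative (\<lambda>v. v $ j)) (at z)"
  by (rule bounded_linear_imp_has_derivative[OF bounded_linear_vec_nth])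

text \<open>
  Polynomial functions are stable under directional derivatives. This makes all iterated derivatives in
  the Laplacian and all integrands below polynomial again.
\<close>

lemma polynomial_function_derivative:
  assumes "f \<in> polynomial_functions"
  shows "f differentiable (at z)" "dir_deriv f v \<in> polynomial_functions"
proof -
  have "(\<forall>z. f differentiable (at z)) \<and> dir_deriv f v \<in> polynomial_functions"
    using assms
  proof induction
    case (gen f)
    then consider j where "f = (\<lambda>z. z $ j)" | j where "f = (\<lambda>z. cnj (z $ j))" by auto
    then show ?case
    proof cases
      case 1
      have "(f has_derivative (\<lambda>v. v $ j)) (at z)" for z
        unfolding 1 by (rule has_derivative_coord)
      then have "dir_deriv f v = (\<lambda>z. v $ j)" "\<And>z. f differentiable (at z)"
        by (auto simp: fun_eq_iff differentiable_def intro!: dir_deriv_eqI)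
      then show ?thesis by (simp add: generated_algebra.const)
    next
      case 2
      have "(f has_derivative (\<lambda>v. cnj (v $ j))) (at z)" for z
        unfolding 2 by (intro has_derivative_cnj has_derivative_coord)
      then have "dir_deriv f v = (\<lambda>z. cnj (v $ j))" "\<And>z. f differentiable (at z)"
        by (auto simp: fun_eq_iff differentiable_def intro!: dir_deriv_eqI)
      then show ?thesis by (simp add: generated_algebra.const)
    qed
  next
    case (const c)
    have "dir_deriv (\<lambda>z. c) v = (\<lambda>z. 0)"
      by (rule ext, rule dir_deriv_eqI[where f' = "\<lambda>v. 0"]) simp
    then show ?case by (simp add: generated_algebra.const)
  next
    case (add f g)
    then have "dir_deriv (\<lambda>x. f x + g x) v = (\<lambda>z. dir_deriv f v z + dir_deriv g v z)"
      by (simp add: dir_deriv_add fun_eq_iff)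
    then show ?case using add by (simp add: generated_algebra.add differentiable_add)
  next
    case (mult f g)
    then have "dir_deriv (\<lambda>x. f x * g x) v = (\<lambda>z. f z * dir_deriv g v z + dir_deriv f v z * g z)"
      by (simp add: dir_deriv_mult fun_eq_iff)
    then show ?case using mult by (simp add: generated_algebra.add generated_algebra.mult differentiable_mult)
  qed
  then show "f differentiable (at z)" "dir_deriv f v \<in> polynomial_functions" by auto
qed

section \<open>Barycentre and dispersion\<close>

lemma inner_complex_Re: "(a::complex) \<bullet> b = Re (a * cnj b)"
  by (simp add: inner_complex_def)

lemma linear_S_poly: "linear (S_poly :: complex ^ 'n::finite \<Rightarrow> complex)"
  by (rule linearI) (simp_all add: S_poly_def sum.distrib scaleR_sum_right)

lemmas bounded_linear_S_poly = linear_S_poly[THEN linear_conv_bounded_linear[THEN iffD1]]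

text \<open>
  The complex-linear form \<open>S\<close> in terms of the real inner product: its real and imaginary parts pair with
  the diagonal vectors \<open>(1, ..., 1)\<close> and \<open>(\<i>, ..., \<i>)\<close>.
\<close>

lemma S_poly_eq_inner:
  "S_poly v = of_real (vec 1 \<bullet> v) + \<i> * of_real (vec \<i> \<bullet> v)"
  by (rule complex_eqI) (simp_all add: S_poly_def inner_vec_def inner_complex_def)

lemma sum_pairs_less:
  fixes f :: "'n::{finite,linorder} \<Rightarrow> 'n \<Rightarrow> 'b::comm_monoid_add"
  assumes "\<And>j k. f j k = f k j"
  shows "(\<Sum>(j,k)\<in>{(j,k). j < k}. f j k) + (\<Sum>(j,k)\<in>{(j,k). j < k}. f j k)
    = (\<Sum>(j,k)\<in>{(j,k). j \<noteq> k}. f j k)"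
proof -
  have "(\<Sum>(j,k)\<in>{(j,k). j < k}. f j k) = (\<Sum>(j,k)\<in>{(j,k). k < j}. f j k)"
    by (rule sum.reindex_bij_witness[where i = prod.swap and j = prod.swap]) (auto simp: assms)
  moreover have "{(j,k). j \<noteq> k} = {(j,k). j < k} \<union> {(j::'n,k). k < j}"
    by auto
  moreover have "(\<Sum>(j,k)\<in>{(j,k). j < k} \<union> {(j,k). k < j}. f j k)
      = (\<Sum>(j,k)\<in>{(j,k). j < k}. f j k) + (\<Sum>(j,k)\<in>{(j,k). k < j}. f j k)"
    by (rule sum.union_disjoint) (auto intro: finite_subset[OF subset_UNIV])
  ultimately show ?thesis by simp
qed

lemma sum_pairs_neq:
  fixes f :: "'n::finite \<Rightarrow> 'n \<Rightarrow> 'b::comm_monoid_add"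
  assumes "\<And>j. f j j = 0"
  shows "(\<Sum>(j,k)\<in>{(j,k). j \<noteq> k}. f j k) = (\<Sum>j\<in>UNIV. \<Sum>k\<in>UNIV. f j k)"
  unfolding sum.cartesian_product
  by (rule sum.mono_neutral_left) (auto simp: assms)

lemma norm_vec_square: "(\<Sum>j\<in>UNIV. (cmod (z $ j))\<^sup>2) = z \<bullet> z"
  by (simp add: inner_vec_def flip: power2_norm_eq_inner)

lemma R_poly_eq_inner:
  fixes z :: "complex ^ 'n::{finite,linorder}"
  shows "R_poly z = real CARD('n) * (z \<bullet> z) - S_poly z \<bullet> S_poly z"
proof -
  have "R_poly z + R_poly z = (\<Sum>j\<in>UNIV. \<Sum>k\<in>UNIV. (cmod (z $ j - z $ k))\<^sup>2)"
    unfolding R_poly_def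
    by (subst sum_pairs_less) (auto simp: norm_minus_commute intro: sum_pairs_neq)
  also have "\<dots> = (\<Sum>j\<in>UNIV. \<Sum>k\<in>UNIV. z $ j \<bullet> z $ j + z $ k \<bullet> z $ k - 2 * (z $ j \<bullet> z $ k))"
    by (simp add: power2_norm_eq_inner inner_diff inner_commute algebra_simps)
  also have "\<dots> = 2 * (real CARD('n) * (z \<bullet> z)) - 2 * (S_poly z \<bullet> S_poly z)"
    by (simp add: sum.distrib sum_subtractf S_poly_def inner_sum_left inner_sum_right inner_vec_def
        flip: sum_distrib_left) (simp add: inner_commute)
  finally show ?thesis by simp
qed

text \<open>
  This is \<open>n\<close> times the displacement of each point from the barycentre. As a vector field it is half the
  gradient of \<open>R_poly\<close>, and it generates the dilations that fix the barycentre.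
\<close>

definition centered :: "complex ^ 'n::finite \<Rightarrow> complex ^ 'n" where
  "centered z = (\<chi> j. of_nat CARD('n) * z $ j - S_poly z)"

lemma centered_inner:
  fixes v w :: "complex ^ 'n::finite"
  shows "centered v \<bullet> w = real CARD('n) * (v \<bullet> w) - S_poly v \<bullet> S_poly w"
proof -
  have "centered v \<bullet> w = (\<Sum>j\<in>UNIV. real CARD('n) * (v $ j \<bullet> w $ j) - S_poly v \<bullet> w $ j)"
    unfolding inner_vec_def centered_def
    by (simp add: inner_diff_left inner_complex_def algebra_simps)
  then show ?thesis
    by (simp add: sum_subtractf S_poly_def inner_sum_right inner_vec_def sum_distrib_left)
qed

lemma S_poly_vec [simp]: "S_poly (vec c :: complex ^ 'n::finite) = of_nat CARD('n) * c"
  by (simp add: S_poly_def)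

lemma S_poly_1 [simp]: "S_poly (1 :: complex ^ 'n::finite) = of_nat CARD('n)"
  by (simp add: S_poly_def)

lemma S_poly_centered [simp]: "S_poly (centered z) = 0"
  by (simp add: S_poly_def centered_def sum_subtractf sum_distrib_left)

lemma linear_centered: "linear (centered :: complex ^ 'n::finite \<Rightarrow> complex ^ 'n)"
  by (rule linearI)
    (simp_all add: centered_def vec_eq_iff linear_add[OF linear_S_poly] linear_scale[OF linear_S_poly]
      algebra_simps)

lemma centered_inner_commute: "centered v \<bullet> w = v \<bullet> centered w"
  by (metis centered_inner inner_commute)

lemma centered_inner_vec [simp]: "centered z \<bullet> vec c = 0"
proof -
  have "centered z \<bullet> vec c = S_poly (centered z) \<bullet> c"
    by (simp add: inner_vec_def S_poly_def inner_sum_left)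
  then show ?thesis by simp
qed

lemma R_poly_eq_centered: "R_poly z = centered z \<bullet> z"
  by (simp add: centered_inner R_poly_eq_inner)

lemma centered_norm:
  fixes z :: "complex ^ 'n::{finite,linorder}"
  shows "centered z \<bullet> centered z = real CARD('n) * R_poly z"
  by (simp add: centered_inner[of z "centered z"] R_poly_eq_centered inner_commute)

lemma R_poly_centered_sum:
  fixes z :: "complex ^ 'n::{finite,linorder}"
  shows "R_poly z = real CARD('n) * (\<Sum>j\<in>UNIV. (cmod (z $ j - S_poly z / of_nat CARD('n)))\<^sup>2)"
proof -
  have "(cmod (z $ j - S_poly z / of_nat CARD('n)))\<^sup>2
      = (centered z $ j \<bullet> centered z $ j) / (real CARD('n))\<^sup>2" for j
  proof -
    have "centered z $ j = of_nat CARD('n) * (z $ j - S_poly z / of_nat CARD('n))"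
      by (simp add: centered_def field_simps)
    then show ?thesis
      by (simp add: norm_mult power_mult_distrib flip: power2_norm_eq_inner)
  qed
  then have "(\<Sum>j\<in>UNIV. (cmod (z $ j - S_poly z / of_nat CARD('n)))\<^sup>2)
      = (centered z \<bullet> centered z) / (real CARD('n))\<^sup>2"
    by (simp add: inner_vec_def sum_divide_distrib)
  then show ?thesis
    by (simp add: centered_norm power2_eq_square)
qed

lemma has_derivative_S_poly [derivative_intros]:
  "(S_poly has_derivative S_poly) (at z)"
  by (rule bounded_linear_imp_has_derivative[OF bounded_linear_S_poly])

lemma has_derivative_R_poly [derivative_intros]:
  fixes z :: "complex ^ 'n::{finite,linorder}"
  shows "(R_poly has_derivative (\<lambda>v. 2 * (centered z \<bullet> v))) (at z)"
proof -
  have "((\<lambda>z. real CARD('n) * (z \<bullet> z) - S_poly z \<bullet> S_poly z) has_derivative (\<lambda>v. 2 * (centered z \<bullet> v))) (at z)"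
    by (auto intro!: derivative_eq_intros simp: centered_inner fun_eq_iff inner_commute[of _ z]
        inner_commute[of _ "S_poly z"] algebra_simps)
  then show ?thesis by (simp add: R_poly_eq_inner[abs_def])
qed

text \<open>
  The contractions over an orthonormal basis that occur in the Laplacian and in the drift. Since \<open>S\<close> pairs
  a vector with two orthogonal diagonal vectors of equal length, each contraction is an instance of the
  basis expansion of a linear form or of an inner product, or a trace.
\<close>

lemma sum_Basis_S_poly:
  fixes z u :: "complex ^ 'n::{finite,linorder}"
  shows "(\<Sum>b\<in>Basis. of_real (u \<bullet> b) * S_poly b) = S_poly u"
    "(\<Sum>b\<in>Basis. of_real (u \<bullet> b) * cnj (S_poly b)) = cnj (S_poly u)"
    "(\<Sum>b\<in>Basis. S_poly (b :: (complex, 'n) vec) * S_poly b) = 0"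
    "(\<Sum>b\<in>Basis. cnj (S_poly (b :: (complex, 'n) vec)) * cnj (S_poly b)) = 0"
    "(\<Sum>b\<in>Basis. S_poly (b :: (complex, 'n) vec) * cnj (S_poly b)) = 2 * of_nat CARD('n)"
    "(\<Sum>b\<in>Basis. centered z \<bullet> b * (centered z \<bullet> b)) = real CARD('n) * R_poly z"
    "(\<Sum>b\<in>Basis. centered b \<bullet> (b :: (complex, 'n) vec)) = 2 * real CARD('n) * (real CARD('n) - 1)"
proof -
  have lin: "h (\<Sum>b\<in>Basis. (u \<bullet> b) *\<^sub>R b) = (\<Sum>b\<in>Basis. of_real (u \<bullet> b) * h b)"
    if "linear h" for h :: "(complex, 'n) vec \<Rightarrow> complex" and u :: "(complex, 'n) vec"
    using that by (simp add: linear_sum linear_scale scaleR_conv_of_real[where 'a = complex])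
  have lc: "linear (\<lambda>v :: (complex, 'n) vec. cnj (S_poly v))"
    by (intro bounded_linear.linear bounded_linear_compose[OF bounded_linear_cnj] bounded_linear_S_poly)
  show 1: "(\<Sum>b\<in>Basis. of_real (u \<bullet> b) * S_poly b) = S_poly u" for u :: "(complex, 'n) vec"
    using lin[OF linear_S_poly, of u] by (simp add: euclidean_representation)
  show 2: "(\<Sum>b\<in>Basis. of_real (u \<bullet> b) * cnj (S_poly b)) = cnj (S_poly u)" for u :: "(complex, 'n) vec"
    using lin[OF lc, of u] by (simp add: euclidean_representation)
  show "(\<Sum>b\<in>Basis. S_poly (b :: (complex, 'n) vec) * S_poly b) = 0"
    by (subst S_poly_eq_inner)
      (simp add: distrib_right sum.distrib mult.assoc 1 flip: sum_distrib_left,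
        simp add: mult.commute[of "of_nat CARD('n)" \<i>])
  show "(\<Sum>b\<in>Basis. S_poly (b :: (complex, 'n) vec) * cnj (S_poly b)) = 2 * of_nat CARD('n)"
    by (subst S_poly_eq_inner)
      (simp add: distrib_right sum.distrib mult.assoc 2 flip: sum_distrib_left,
        simp add: mult.commute[of "of_nat CARD('n)" \<i>])
  show "(\<Sum>b\<in>Basis. cnj (S_poly (b :: (complex, 'n) vec)) * cnj (S_poly b)) = 0"
    by (subst S_poly_eq_inner)
      (simp add: left_diff_distrib sum_subtractf mult.assoc 2 flip: sum_distrib_left,
        simp add: mult.commute[of "of_nat CARD('n)" \<i>])
  show "(\<Sum>b\<in>Basis. centered z \<bullet> b * (centered z \<bullet> b)) = real CARD('n) * R_poly z"
    by (simp add: centered_norm flip: euclidean_inner)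
  have "(\<Sum>b\<in>Basis. S_poly b \<bullet> S_poly (b :: (complex, 'n) vec)) = Re (\<Sum>b\<in>Basis. S_poly (b :: (complex, 'n) vec) * cnj (S_poly b))"
    by (simp add: inner_complex_Re)
  also have "\<dots> = 2 * real CARD('n)"
    by (simp add: \<open>(\<Sum>b\<in>Basis. S_poly (b :: (complex, 'n) vec) * cnj (S_poly b)) = 2 * of_nat CARD('n)\<close>)
  finally show "(\<Sum>b\<in>Basis. centered b \<bullet> (b :: (complex, 'n) vec)) = 2 * real CARD('n) * (real CARD('n) - 1)"
    by (simp add: centered_inner sum_subtractf flip: sum_distrib_left) (simp add: algebra_simps)
qed

text \<open>
  The Hermite factor in \<open>S\<close> times an arbitrary polynomial in \<open>R\<close>. Leaving \<open>p\<close> free makes the family stable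
  under differentiation: a derivative lowers \<open>a\<close> or \<open>b\<close>, or replaces \<open>p\<close> by \<open>pderiv p\<close>.
\<close>

definition hermite_radial :: "nat \<Rightarrow> nat \<Rightarrow> real poly \<Rightarrow> complex ^ 'n::{finite,linorder} \<Rightarrow> complex" where
  "hermite_radial a b p z = ito a b (S_poly z) (cnj (S_poly z)) * of_real (poly p (R_poly z))"

lemma S_poly_polynomial: "S_poly \<in> polynomial_functions" "(\<lambda>z. cnj (S_poly z)) \<in> polynomial_functions"
  unfolding S_poly_def[abs_def] cnj_sum by (intro generated_algebra_closure coord_polynomial)+

lemma R_poly_polynomial:
  "(\<lambda>z :: complex ^ 'n::{finite,linorder}. complex_of_real (R_poly z)) \<in> polynomial_functions"
proof -
  have "(\<lambda>z :: (complex, 'n) vec. complex_of_real (R_poly z)) = (\<lambda>z. of_nat CARD('n) * (\<Sum>j\<in>UNIV. z $ j * cnj (z $ j)) - S_poly z * cnj (S_poly (z :: (complex, 'n) vec)))"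
    by (simp only: R_poly_eq_inner of_real_diff of_real_mult of_real_of_nat_eq of_real_sum
        norm_vec_square[symmetric] power2_norm_eq_inner[symmetric] complex_norm_square)
  also have "\<dots> \<in> polynomial_functions"
    by (intro generated_algebra_closure coord_polynomial S_poly_polynomial)
  finally show ?thesis .
qed

lemma hermite_radial_polynomial: "hermite_radial a b p \<in> polynomial_functions"
  unfolding hermite_radial_def[abs_def]
  by (intro generated_algebra_closure S_poly_polynomial R_poly_polynomial)

lemma has_derivative_hermite_radial [derivative_intros]:
  "(hermite_radial a b p has_derivative
     (\<lambda>v. of_nat a * S_poly v * hermite_radial (a - 1) b p z
        + of_nat b * cnj (S_poly v) * hermite_radial a (b - 1) p z
        + of_real (2 * (centered z \<bullet> v)) * hermite_radial a b (pderiv p) z)) (at z)"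
proof -
  have "((\<lambda>z. poly p (R_poly z)) has_derivative (\<lambda>v. 2 * (centered z \<bullet> v) * poly (pderiv p) (R_poly z))) (at z)"
    by (rule has_derivative_eq_rhs[OF has_derivative_compose[OF has_derivative_R_poly
            poly_DERIV[unfolded has_field_derivative_def]]]) (simp add: mult.commute fun_eq_iff)
  then show ?thesis
    unfolding hermite_radial_def[abs_def]
    by (auto intro!: derivative_eq_intros simp: fun_eq_iff algebra_simps)
qed

lemmas dir_deriv_hermite_radial = dir_deriv_eqI[OF has_derivative_hermite_radial]

text \<open>
  The terms are grouped by the pair of first order factors in \<open>v\<close>, to match the contractions in
  \<open>sum_Basis_S_poly\<close>.
\<close>

lemma dir_deriv2_hermite_radial:
  fixes z :: "complex ^ 'n::{finite,linorder}"
  shows "dir_deriv (dir_deriv (hermite_radial a b p) v) v z =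
    S_poly v * S_poly v * (of_nat a * of_nat (a - 1) * hermite_radial (a - 1 - 1) b p z)
  + cnj (S_poly v) * cnj (S_poly v) * (of_nat b * of_nat (b - 1) * hermite_radial a (b - 1 - 1) p z)
  + S_poly v * cnj (S_poly v) * (2 * of_nat a * of_nat b * hermite_radial (a - 1) (b - 1) p z)
  + of_real (centered z \<bullet> v) * S_poly v * (4 * of_nat a * hermite_radial (a - 1) b (pderiv p) z)
  + of_real (centered z \<bullet> v) * cnj (S_poly v) * (4 * of_nat b * hermite_radial a (b - 1) (pderiv p) z)
  + of_real (centered v \<bullet> v) * (2 * hermite_radial a b (pderiv p) z)
  + of_real (centered z \<bullet> v * (centered z \<bullet> v)) * (4 * hermite_radial a b (pderiv (pderiv p)) z)"
proof -
  have X: "(centered has_derivative centered) (at z)"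
    by (intro bounded_linear_imp_has_derivative
        linear_centered[THEN linear_conv_bounded_linear[THEN iffD1]])
  have "((\<lambda>z. of_nat a * S_poly v * hermite_radial (a - 1) b p z
        + of_nat b * cnj (S_poly v) * hermite_radial a (b - 1) p z
        + of_real (2 * (centered z \<bullet> v)) * hermite_radial a b (pderiv p) z) has_derivative
    (\<lambda>w. of_nat a * S_poly v * (of_nat (a - 1) * S_poly w * hermite_radial (a - 1 - 1) b p z
          + of_nat b * cnj (S_poly w) * hermite_radial (a - 1) (b - 1) p z
          + of_real (2 * (centered z \<bullet> w)) * hermite_radial (a - 1) b (pderiv p) z)
      + of_nat b * cnj (S_poly v) * (of_nat a * S_poly w * hermite_radial (a - 1) (b - 1) p z
          + of_nat (b - 1) * cnj (S_poly w) * hermite_radial a (b - 1 - 1) p z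
          + of_real (2 * (centered z \<bullet> w)) * hermite_radial a (b - 1) (pderiv p) z)
      + (of_real (2 * (centered z \<bullet> v)) * (of_nat a * S_poly w * hermite_radial (a - 1) b (pderiv p) z
          + of_nat b * cnj (S_poly w) * hermite_radial a (b - 1) (pderiv p) z
          + of_real (2 * (centered z \<bullet> w)) * hermite_radial a b (pderiv (pderiv p)) z)
        + of_real (2 * (centered w \<bullet> v)) * hermite_radial a b (pderiv p) z))) (at z)"
    by (intro has_derivative_add has_derivative_mult has_derivative_mult_right has_derivative_of_real
        has_derivative_inner_left X has_derivative_hermite_radial)
  then show ?thesis
    unfolding dir_deriv_hermite_radial[of a b p v, abs_def]
    by (rule dir_deriv_eqI[THEN trans]) (simp only: of_real_mult of_real_numeral, algebra)
qed

text \<open>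
  The terms in \<open>(\<partial> h)\<close> times \<open>p'\<close> drop out because the gradients of \<open>S\<close> and \<open>R\<close> are orthogonal, and the
  second derivatives of the same type in \<open>S\<close> drop out because \<open>S\<close> is holomorphic.
\<close>

lemma euclidean_laplacian_hermite_radial:
  fixes z :: "complex ^ 'n::{finite,linorder}"
  shows "(\<Sum>v\<in>Basis. dir_deriv (dir_deriv (hermite_radial a b p) v) v z) =
    4 * of_nat CARD('n) * (of_nat a * of_nat b * hermite_radial (a - 1) (b - 1) p z
      + (of_nat CARD('n) - 1) * hermite_radial a b (pderiv p) z
      + of_real (R_poly z) * hermite_radial a b (pderiv (pderiv p)) z)"
proof -
  have "(\<Sum>v\<in>Basis. dir_deriv (dir_deriv (hermite_radial a b p) v) v z) =
    (\<Sum>v\<in>Basis. S_poly (v :: (complex, 'n) vec) * S_poly v) * (of_nat a * of_nat (a - 1) * hermite_radial (a - 1 - 1) b p z)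
  + (\<Sum>v\<in>Basis. cnj (S_poly (v :: (complex, 'n) vec)) * cnj (S_poly v)) * (of_nat b * of_nat (b - 1) * hermite_radial a (b - 1 - 1) p z)
  + (\<Sum>v\<in>Basis. S_poly (v :: (complex, 'n) vec) * cnj (S_poly v)) * (2 * of_nat a * of_nat b * hermite_radial (a - 1) (b - 1) p z)
  + (\<Sum>v\<in>Basis. of_real (centered z \<bullet> v) * S_poly v) * (4 * of_nat a * hermite_radial (a - 1) b (pderiv p) z)
  + (\<Sum>v\<in>Basis. of_real (centered z \<bullet> v) * cnj (S_poly v)) * (4 * of_nat b * hermite_radial a (b - 1) (pderiv p) z)
  + of_real (\<Sum>v\<in>Basis. centered v \<bullet> (v :: (complex, 'n) vec)) * (2 * hermite_radial a b (pderiv p) z)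
  + of_real (\<Sum>v\<in>Basis. centered z \<bullet> v * (centered z \<bullet> v)) * (4 * hermite_radial a b (pderiv (pderiv p)) z)"
    by (simp only: dir_deriv2_hermite_radial sum.distrib sum_distrib_right of_real_sum)
  then show ?thesis
    unfolding sum_Basis_S_poly
    by (simp only: S_poly_centered complex_cnj_zero mult_zero_left of_real_mult of_real_diff
        of_real_numeral of_real_1 of_real_of_nat_eq) (simp add: algebra_simps)
qed

section \<open>The generator on polynomial functions\<close>

definition energy_deriv :: "complex ^ 'n::finite \<Rightarrow> complex ^ 'n \<Rightarrow> real" where
  "energy_deriv z v =
     2 * (z \<bullet> v) / real CARD('n) -
     (\<Sum>(j,k)\<in>{(j,k). j \<noteq> k}. (z $ j - z $ k) \<bullet> (v $ j - v $ k) / ((z $ j - z $ k) \<bullet> (z $ j - z $ k)))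
       / (real CARD('n))\<^sup>2"

lemma has_derivative_energy:
  fixes z :: "complex ^ 'n::finite"
  assumes "z \<in> distinct_points"
  shows "(energy has_derivative energy_deriv z) (at z)"
proof -
  \<comment> \<open>This also holds for \<open>w = 0\<close>, since \<open>1 / 0 = 0\<close> and \<open>ln 0 = 0\<close>; so it can be used under the sum for
    all configurations.\<close>
  have "ln (1 / cmod w) = - ln (w \<bullet> w) / 2" for w
    by (cases "w = 0") (simp_all add: ln_div ln_realpow flip: power2_norm_eq_inner)
  then have energy: "energy = (\<lambda>z :: (complex, 'n) vec. (z \<bullet> z) / real CARD('n) +
     (\<Sum>p\<in>{(j,k). j \<noteq> k}. - ln ((z $ fst p - z $ snd p) \<bullet> (z $ fst p - z $ snd p)) / 2) / (real CARD('n))\<^sup>2)"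
    by (simp add: energy_def fun_eq_iff norm_vec_square case_prod_unfold)
  have "((\<lambda>z. - ln ((z $ fst p - z $ snd p) \<bullet> (z $ fst p - z $ snd p)) / 2) has_derivative
      (\<lambda>v. - ((z $ fst p - z $ snd p) \<bullet> (v $ fst p - v $ snd p)
        / ((z $ fst p - z $ snd p) \<bullet> (z $ fst p - z $ snd p))))) (at z)"
    if "p \<in> {(j,k). j \<noteq> k}" for p
  proof -
    have "z $ fst p \<noteq> z $ snd p"
      using that assms by (auto simp: distinct_points_def)
    then have pos: "(z $ fst p - z $ snd p) \<bullet> (z $ fst p - z $ snd p) > 0"
      by simp
    have d: "((\<lambda>z. z $ fst p - z $ snd p) has_derivative (\<lambda>v. v $ fst p - v $ snd p)) (at z)"
      by (intro has_derivative_diff has_derivative_coord)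
    have "((\<lambda>z. - (1 / 2) * ln ((z $ fst p - z $ snd p) \<bullet> (z $ fst p - z $ snd p))) has_derivative
      (\<lambda>v. - (1 / 2) * (((z $ fst p - z $ snd p) \<bullet> (v $ fst p - v $ snd p)
          + (v $ fst p - v $ snd p) \<bullet> (z $ fst p - z $ snd p))
        * inverse ((z $ fst p - z $ snd p) \<bullet> (z $ fst p - z $ snd p))))) (at z)"
      by (intro has_derivative_mult_right has_derivative_ln pos has_derivative_inner d)
    moreover have "- (1 / 2) * ((u \<bullet> v + v \<bullet> u) * inverse (u \<bullet> u)) = - (u \<bullet> v / (u \<bullet> u))" for u v :: complex
      by (simp add: inner_commute[of v u] inverse_eq_divide)
    ultimately show ?thesis by simp
  qed
  then have s: "((\<lambda>z. \<Sum>p\<in>{(j,k). j \<noteq> k}. - ln ((z $ fst p - z $ snd p) \<bullet> (z $ fst p - z $ snd p)) / 2) has_derivative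
      (\<lambda>v. \<Sum>p\<in>{(j,k). j \<noteq> k}. - ((z $ fst p - z $ snd p) \<bullet> (v $ fst p - v $ snd p)
        / ((z $ fst p - z $ snd p) \<bullet> (z $ fst p - z $ snd p))))) (at z)"
    by (rule has_derivative_sum)
  have q: "((\<lambda>z. (z \<bullet> z) / real CARD('n)) has_derivative (\<lambda>v. 2 * (z \<bullet> v) / real CARD('n))) (at z)"
    by (auto intro!: derivative_eq_intros simp: inner_commute)
  have "(energy has_derivative (\<lambda>v. 2 * (z \<bullet> v) / real CARD('n) +
     (\<Sum>p\<in>{(j,k). j \<noteq> k}. - ((z $ fst p - z $ snd p) \<bullet> (v $ fst p - v $ snd p)
        / ((z $ fst p - z $ snd p) \<bullet> (z $ fst p - z $ snd p)))) / (real CARD('n))\<^sup>2)) (at z)"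
    unfolding energy divide_inverse[of "sum _ _"]
    by (intro has_derivative_add q has_derivative_mult_left s)
  then show ?thesis
    by (simp add: energy_deriv_def[abs_def] case_prod_unfold sum_negf)
qed

lemma linear_energy_deriv:
  assumes "z \<in> distinct_points"
  shows "linear (energy_deriv z)"
  by (rule has_derivative_linear[OF has_derivative_energy[OF assms]])

text \<open>
  The generator as a complex-linear operator. It agrees with \<open>generator\<close>, which treats real and imaginary
  parts separately, on polynomial functions and away from collisions; here product rules apply directly
  to complex-valued functions.
\<close>

definition generator_poly :: "real \<Rightarrow> (complex ^ 'n::finite \<Rightarrow> complex) \<Rightarrow> complex ^ 'n \<Rightarrow> complex" where
  "generator_poly \<alpha> f z =
    of_real \<alpha> * ((\<Sum>b\<in>Basis. dir_deriv (dir_deriv f b) b z) / (of_nat CARD('n))\<^sup>2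
      - (\<Sum>b\<in>Basis. of_real (energy_deriv z b) * dir_deriv f b z))"

lemma generator_eq_generator_poly:
  fixes f :: "complex ^ 'n::finite \<Rightarrow> complex"
  assumes f: "f \<in> polynomial_functions" and z: "z \<in> distinct_points"
  shows "generator \<alpha> f z = generator_poly \<alpha> f z"
proof -
  have grad: "generator_real \<alpha> (\<lambda>w. h (f w)) z = \<alpha> * (h (\<Sum>b\<in>Basis. dir_deriv (dir_deriv f b) b z) / (real CARD('n))\<^sup>2
      - (\<Sum>b\<in>Basis. energy_deriv z b * h (dir_deriv f b z)))"
    if h: "bounded_linear h" for h
  proof -
    have 1: "dir_deriv (\<lambda>w. h (f w)) b = (\<lambda>w. h (dir_deriv f b w))" for b
      by (rule ext) (intro dir_deriv_bounded_linear_comp h polynomial_function_derivative(1) f)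
    have 2: "dir_deriv (\<lambda>w. h (dir_deriv f b w)) b z = h (dir_deriv (dir_deriv f b) b z)" for b
      by (intro dir_deriv_bounded_linear_comp h polynomial_function_derivative f)
    have 3: "laplacian (\<lambda>w. h (f w)) z = h (\<Sum>b\<in>Basis. dir_deriv (dir_deriv f b) b z)"
      by (simp add: laplacian_def 1 2 linear_sum[OF bounded_linear.linear[OF h]])
    have 4: "gradient g z \<bullet> b = dir_deriv g b z" if "b \<in> Basis" for g b
      using that by (simp add: gradient_def inner_sum_left_Basis)
    have 5: "gradient energy z \<bullet> gradient (\<lambda>w. h (f w)) z
        = (\<Sum>b\<in>Basis. energy_deriv z b * h (dir_deriv f b z))"
      by (subst euclidean_inner) (simp add: 4 1 dir_deriv_eqI[OF has_derivative_energy[OF z]])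
    show ?thesis
      by (simp add: generator_real_def 3 5)
  qed
  define N where "N = (real CARD('n))\<^sup>2"
  have N: "(of_nat CARD('n))\<^sup>2 = complex_of_real N"
    by (simp add: N_def)
  show ?thesis
    unfolding generator_def generator_poly_def N grad[OF bounded_linear_Re] grad[OF bounded_linear_Im]
      N_def[symmetric]
    by (rule complex_eqI) simp_all
qed

lemma generator_poly_add:
  fixes f g :: "complex ^ 'n::finite \<Rightarrow> complex"
  assumes "f \<in> polynomial_functions" "g \<in> polynomial_functions"
  shows "generator_poly \<alpha> (\<lambda>z. f z + g z) z = generator_poly \<alpha> f z + generator_poly \<alpha> g z"
proof -
  have 1: "dir_deriv (\<lambda>w. f w + g w) b = (\<lambda>w. dir_deriv f b w + dir_deriv g b w)" for b
    by (rule ext) (intro dir_deriv_add polynomial_function_derivative(1) assms)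
  have 2: "dir_deriv (\<lambda>w. dir_deriv f b w + dir_deriv g b w) b z =
      dir_deriv (dir_deriv f b) b z + dir_deriv (dir_deriv g b) b z" for b
    by (intro dir_deriv_add polynomial_function_derivative assms)
  show ?thesis
    by (simp add: generator_poly_def 1 2 sum.distrib distrib_left add_divide_distrib right_diff_distrib)
qed

lemma generator_poly_cmult:
  fixes f :: "complex ^ 'n::finite \<Rightarrow> complex"
  assumes "f \<in> polynomial_functions"
  shows "generator_poly \<alpha> (\<lambda>z. c * f z) z = c * generator_poly \<alpha> f z"
proof -
  have 1: "dir_deriv (\<lambda>w. c * f w) b = (\<lambda>w. c * dir_deriv f b w)" for b
    by (rule ext) (intro dir_deriv_bounded_linear_comp bounded_linear_mult_right polynomial_function_derivative(1) assms)
  have 2: "dir_deriv (\<lambda>w. c * dir_deriv f b w) b z = c * dir_deriv (dir_deriv f b) b z" for b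
    by (intro dir_deriv_bounded_linear_comp bounded_linear_mult_right polynomial_function_derivative assms)
  show ?thesis
    by (simp add: generator_poly_def 1 2 mult.left_commute[of _ c] right_diff_distrib flip: sum_distrib_left)
qed

lemma energy_deriv_vec: "energy_deriv z (vec c) = 2 * (S_poly z \<bullet> c) / real CARD('n)"
  for z :: "complex ^ 'n::finite"
  by (simp add: energy_deriv_def inner_vec_def S_poly_def inner_sum_left)

lemma card_pairs_neq: "card {(j, k). j \<noteq> (k :: 'n::finite)} = CARD('n) * (CARD('n) - 1)"
proof -
  have "{(j, k). j \<noteq> (k :: 'n)} = Sigma UNIV (\<lambda>j. UNIV - {j})" by auto
  then show ?thesis by simp
qed

text \<open>
  A dilation multiplies all differences \<open>z\<^sub>j - z\<^sub>k\<close> by the same factor, so each of the \<open>n (n - 1)\<close> ordered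
  pairs contributes the same constant to the derivative of the interaction, whatever the configuration.
\<close>

lemma energy_deriv_centered:
  fixes z :: "complex ^ 'n::{finite,linorder}"
  assumes "z \<in> distinct_points"
  shows "energy_deriv z (centered z) = 2 * R_poly z / real CARD('n) - (real CARD('n) - 1)"
proof -
  have "(\<Sum>(j,k)\<in>{(j,k). j \<noteq> k}. (z $ j - z $ k) \<bullet> (centered z $ j - centered z $ k) / ((z $ j - z $ k) \<bullet> (z $ j - z $ k)))
      = (\<Sum>(j,k)\<in>{(j,k :: 'n). j \<noteq> k}. real CARD('n))"
  proof (rule sum.cong[OF refl], clarify)
    fix j k :: 'n assume "j \<noteq> k"
    then have "(z $ j - z $ k) \<bullet> (z $ j - z $ k) \<noteq> 0"
      using assms by (auto simp: distinct_points_def)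
    moreover have "centered z $ j - centered z $ k = real CARD('n) *\<^sub>R (z $ j - z $ k)"
      by (simp add: centered_def scaleR_conv_of_real algebra_simps)
    ultimately show "(z $ j - z $ k) \<bullet> (centered z $ j - centered z $ k) / ((z $ j - z $ k) \<bullet> (z $ j - z $ k)) = real CARD('n)"
      by simp
  qed
  also have "\<dots> = (real CARD('n))\<^sup>2 * (real CARD('n) - 1)"
    by (simp add: case_prod_unfold card_pairs_neq[unfolded case_prod_unfold] of_nat_diff power2_eq_square Suc_leI)
  finally show ?thesis
    by (simp add: energy_deriv_def R_poly_eq_centered inner_commute)
qed

lemma energy_deriv_hermite_radial:
  fixes z :: "complex ^ 'n::{finite,linorder}"
  assumes z: "z \<in> distinct_points"
  shows "(\<Sum>v\<in>Basis. of_real (energy_deriv z v) * dir_deriv (hermite_radial a b p) v z) =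
    2 / of_nat CARD('n) * (of_nat a * S_poly z * hermite_radial (a - 1) b p z
      + of_nat b * cnj (S_poly z) * hermite_radial a (b - 1) p z
      + of_real (2 * R_poly z - real CARD('n) * (real CARD('n) - 1)) * hermite_radial a b (pderiv p) z)"
proof -
  have lin: "(\<Sum>b\<in>Basis. energy_deriv z b * (u \<bullet> b)) = energy_deriv z u" for u
  proof -
    have "energy_deriv z (\<Sum>b\<in>Basis. (u \<bullet> b) *\<^sub>R b) = (\<Sum>b\<in>Basis. energy_deriv z b * (u \<bullet> b))"
      using linear_energy_deriv[OF z] by (simp add: linear_sum linear_scale mult.commute)
    then show ?thesis by (simp add: euclidean_representation)
  qed
  have S: "(\<Sum>b\<in>Basis. of_real (energy_deriv z b) * S_poly b) = 2 * S_poly z / of_nat CARD('n)"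
  proof -
    have "(\<Sum>b\<in>Basis. of_real (energy_deriv z b) * S_poly b)
        = of_real (\<Sum>b\<in>Basis. energy_deriv z b * (vec 1 \<bullet> b))
          + \<i> * of_real (\<Sum>b\<in>Basis. energy_deriv z b * (vec \<i> \<bullet> b))"
      by (subst S_poly_eq_inner)
        (simp add: distrib_left sum.distrib sum_distrib_left mult.left_commute[of _ \<i>])
    also have "\<dots> = 2 * S_poly z / of_nat CARD('n)"
      unfolding lin energy_deriv_vec
      by (rule complex_eqI) (simp_all add: inner_complex_def)
    finally show ?thesis .
  qed
  have Sc: "(\<Sum>b\<in>Basis. of_real (energy_deriv z b) * cnj (S_poly b)) = 2 * cnj (S_poly z) / of_nat CARD('n)"
    using arg_cong[OF S, of cnj] by simp
  have "(\<Sum>v\<in>Basis. of_real (energy_deriv z v) * dir_deriv (hermite_radial a b p) v z) =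
     (\<Sum>b\<in>Basis. of_real (energy_deriv z b) * S_poly b) * (of_nat a * hermite_radial (a - 1) b p z)
   + (\<Sum>b\<in>Basis. of_real (energy_deriv z b) * cnj (S_poly b)) * (of_nat b * hermite_radial a (b - 1) p z)
   + of_real (\<Sum>b\<in>Basis. energy_deriv z b * (centered z \<bullet> b)) * (2 * hermite_radial a b (pderiv p) z)"
    by (simp add: dir_deriv_hermite_radial sum.distrib sum_distrib_left sum_distrib_right distrib_left mult_ac)
  also have "\<dots> = 2 / of_nat CARD('n) * (of_nat a * S_poly z * hermite_radial (a - 1) b p z
      + of_nat b * cnj (S_poly z) * hermite_radial a (b - 1) p z
      + of_real (2 * R_poly z - real CARD('n) * (real CARD('n) - 1)) * hermite_radial a b (pderiv p) z)"
    unfolding S Sc lin energy_deriv_centered[OF z] by (simp add: field_simps)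
  finally show ?thesis .
qed

text \<open>
  The generator separates into the Hermite operator acting on the factor in \<open>S\<close> and the Laguerre operator
  \<open>x p'' + (\<kappa> - x) p'\<close> acting on \<open>p\<close>. The value of \<open>\<kappa>\<close> collects \<open>n - 1\<close> from the Laplacian of \<open>R\<close> and
  \<open>n (n - 1) / 2\<close> from the interaction.
\<close>

lemma generator_hermite_radial:
  fixes z :: "complex ^ 'n::{finite,linorder}"
  assumes z: "z \<in> distinct_points"
    and ode: "\<And>x. x * poly (pderiv (pderiv p)) x + (kappa CARD('n) - x) * poly (pderiv p) x = - real m * poly p x"
  shows "generator_poly \<alpha> (hermite_radial a b p) z =
    - of_real (2 * (\<alpha> / real CARD('n)) * real (a + b + 2 * m)) * hermite_radial a b p z"
proof -
  define n where "n = complex_of_nat CARD('n)"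
  have n: "n \<noteq> 0" by (simp add: n_def)
  define r where "r = complex_of_real (R_poly z)"
  define s where "s = S_poly z"
  define K where "K = complex_of_real (kappa CARD('n))"
  have K: "K = (n - 1) * (n + 2) / 2"
    by (simp add: K_def kappa_def n_def)
  define q0 q1 q2 where "q0 = complex_of_real (poly p (R_poly z))"
    and "q1 = complex_of_real (poly (pderiv p) (R_poly z))"
    and "q2 = complex_of_real (poly (pderiv (pderiv p)) (R_poly z))"
  have o: "r * q2 + (K - r) * q1 = - of_nat m * q0"
    unfolding r_def q0_def q1_def q2_def K_def
    using arg_cong[OF ode[of "R_poly z"], of complex_of_real] by simp
  define h where "h = ito a b s (cnj s)"
  note e = ito_eigen[of a b s "cnj s"]
  have "generator_poly \<alpha> (hermite_radial a b p) z = of_real \<alpha> * (4 * n * (of_nat a * of_nat b * (ito (a - 1) (b - 1) s (cnj s) * q0)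
      + (n - 1) * (h * q1) + r * (h * q2)) / n\<^sup>2
    - 2 / n * (of_nat a * s * (ito (a - 1) b s (cnj s) * q0) + of_nat b * cnj s * (ito a (b - 1) s (cnj s) * q0)
      + (2 * r - n * (n - 1)) * (h * q1)))"
    unfolding generator_poly_def euclidean_laplacian_hermite_radial energy_deriv_hermite_radial[OF z]
    by (simp add: hermite_radial_def n_def r_def s_def h_def q0_def q1_def q2_def)
  also have "\<dots> = of_real \<alpha> * 2 / n * ((2 * of_nat a * of_nat b * ito (a - 1) (b - 1) s (cnj s)
        - of_nat a * s * ito (a - 1) b s (cnj s) - of_nat b * cnj s * ito a (b - 1) s (cnj s)) * q0
      + 2 * h * (r * q2 + (K - r) * q1))"
  proof -
    define i where "i = 1 / n"
    have 1: "4 * n * x / n\<^sup>2 = 4 * i * x" "2 / n * x = 2 * i * x" "of_real \<alpha> * 2 / n * x = of_real \<alpha> * 2 * i * x" for x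
      using n by (simp_all add: power2_eq_square i_def)
    have 2: "2 * K = (n - 1) * (n + 2)"
      by (simp add: K)
    show ?thesis
      unfolding 1 using 2 by algebra
  qed
  also have "\<dots> = - (2 * (of_real \<alpha> / n) * of_nat (a + b + 2 * m)) * (h * q0)"
    unfolding o e h_def[symmetric] using n by (simp add: field_simps)
  finally show ?thesis
    by (simp add: hermite_radial_def n_def s_def h_def q0_def)
qed

lemma kappa_pos: "n \<ge> 2 \<Longrightarrow> kappa n > 0"
  by (simp add: kappa_def)

lemma P_poly_eq_hermite_radial:
  fixes z :: "complex ^ 'n::{finite,linorder}"
  shows "P_poly a b m z = hermite_const a b * hermite_radial a b (laguerre m (kappa CARD('n) - 1)) z"
  by (simp add: P_poly_def complex_hermite_eq_ito hermite_radial_def)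

lemma laguerre_ode:
  assumes "n \<ge> 2"
  shows "x * poly (pderiv (pderiv (laguerre m (kappa n - 1)))) x
    + (kappa n - x) * poly (pderiv (laguerre m (kappa n - 1))) x = - real m * poly (laguerre m (kappa n - 1)) x"
    and "degree (laguerre m (kappa n - 1)) = m"
  using is_laguerre_laguerre[of "kappa n - 1" m] kappa_pos[OF assms] by (simp_all add: is_laguerre_def)

section \<open>Integration by parts against a Gaussian\<close>

lemma integrable_lborel_translate:
  fixes f :: "'a::euclidean_space \<Rightarrow> 'b::{banach, second_countable_topology}"
  assumes "integrable lborel f"
  shows "integrable lborel (\<lambda>x. f (x + c))" and "(\<integral>x. f (x + c) \<partial>lborel) = (\<integral>x. f x \<partial>lborel)"
proof -
  have f [measurable]: "f \<in> borel_measurable borel"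
    using assms by auto
  have "integrable (distr lborel borel ((+) c)) f"
    using assms by (simp add: lborel_distr_plus)
  then show "integrable lborel (\<lambda>x. f (x + c))"
    by (subst (asm) integrable_distr_eq) (simp_all add: add.commute)
  have "(\<integral>x. f x \<partial>distr lborel borel ((+) c)) = (\<integral>x. f (c + x) \<partial>lborel)"
    by (rule integral_distr) simp_all
  then show "(\<integral>x. f (x + c) \<partial>lborel) = (\<integral>x. f x \<partial>lborel)"
    by (simp add: lborel_distr_plus add.commute)
qed

text \<open>
  The increment \<open>F (x + v) - F x\<close> is the integral of \<open>D (x + t v)\<close> over \<open>0 \<le> t \<le> 1\<close>. Integrating over \<open>x\<close>
  and exchanging the integrals, translation invariance turns the left side into zero and the right side
  into the integral of \<open>D\<close>.
\<close>

lemma integral_dir_deriv_eq_0: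
  fixes F D :: "'a::euclidean_space \<Rightarrow> 'b::euclidean_space"
  assumes F: "integrable lborel F" and D: "integrable lborel D" and cont: "continuous_on UNIV D"
    and deriv: "\<And>x. (F has_derivative F' x) (at x)" "\<And>x. F' x v = D x"
  shows "(\<integral>x. D x \<partial>lborel) = 0"
proof -
  let ?f = "\<lambda>(t::real) x. indicator {0..1} t *\<^sub>R D (x + t *\<^sub>R v)"
  have [measurable]: "D \<in> borel_measurable borel"
    using cont by (rule borel_measurable_continuous_onI)
  note shift = integrable_lborel_translate[OF integrable_norm[OF D]] integrable_lborel_translate[OF D]
  have "integrable (lborel \<Otimes>\<^sub>M lborel) (case_prod ?f)"
  proof (rule lborel_pair.Fubini_integrable)
    show "case_prod ?f \<in> borel_measurable (lborel \<Otimes>\<^sub>M lborel)"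
      by measurable
    have "integrable lborel (\<lambda>t. indicator {0..1::real} t *\<^sub>R (\<integral>x. norm (D x) \<partial>lborel))"
      by (rule integrable_scaleR_left) simp
    then show "integrable lborel (\<lambda>t. \<integral>x. norm (case (t, x) of (t, x) \<Rightarrow> ?f t x) \<partial>lborel)"
      by (simp add: shift)
    show "AE t in lborel. integrable lborel (\<lambda>x. case (t, x) of (t, x) \<Rightarrow> ?f t x)"
      by (simp add: shift)
  qed
  then have "(\<integral>x. (\<integral>t. ?f t x \<partial>lborel) \<partial>lborel) = (\<integral>t. (\<integral>x. ?f t x \<partial>lborel) \<partial>lborel)"
    by (rule lborel_pair.Fubini_integral)
  also have "\<dots> = (\<integral>t. indicator {0..1::real} t *\<^sub>R (\<integral>x. D x \<partial>lborel) \<partial>lborel)"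
    by (simp add: shift)
  also have "\<dots> = (\<integral>x. D x \<partial>lborel)"
    by (subst integral_scaleR_left) simp_all
  also have "(\<lambda>x. \<integral>t. ?f t x \<partial>lborel) = (\<lambda>x. F (x + v) - F x)"
  proof
    fix x
    have "(\<integral>t. ?f t x \<partial>lborel) = F (x + 1 *\<^sub>R v) - F (x + 0 *\<^sub>R v)"
    proof (rule integral_FTC_Icc)
      fix t :: real
      have "((\<lambda>t. F (x + t *\<^sub>R v)) has_derivative (\<lambda>h. F' (x + t *\<^sub>R v) (h *\<^sub>R v))) (at t within {0..1})"
        by (rule has_derivative_compose[OF _ deriv(1)]) (auto intro!: derivative_eq_intros)
      moreover have "F' (x + t *\<^sub>R v) (h *\<^sub>R v) = h *\<^sub>R D (x + t *\<^sub>R v)" for h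
        using linear_scale[OF has_derivative_linear[OF deriv(1)]] by (simp add: deriv(2))
      ultimately show "((\<lambda>t. F (x + t *\<^sub>R v)) has_vector_derivative D (x + t *\<^sub>R v)) (at t within {0..1})"
        by (simp add: has_vector_derivative_def)
    next
      show "continuous_on {0..1} (\<lambda>t. D (x + t *\<^sub>R v))"
        by (rule continuous_on_compose2[OF cont]) (auto intro!: continuous_intros)
    qed simp
    then show "(\<integral>t. ?f t x \<partial>lborel) = F (x + v) - F x" by simp
  qed
  also have "(\<integral>x. F (x + v) - F x \<partial>lborel) = 0"
    by (subst Bochner_Integration.integral_diff) (simp_all add: integrable_lborel_translate[OF F] F)
  finally show ?thesis by simp
qed

text \<open>
  In coordinates the Gaussian is a product of one-dimensional Gaussians, each of finite mass.
\<close>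

lemma integrable_gaussian:
  fixes c :: real
  assumes "c > 0"
  shows "integrable lborel (\<lambda>x :: 'a::euclidean_space. exp (- c * (x \<bullet> x)))"
proof (rule integrableI_bounded)
  \<comment> \<open>The standard deviation of the normal density proportional to \<open>exp (- c t\<^sup>2)\<close>.\<close>
  define \<sigma> where "\<sigma> = sqrt (1 / (2 * c))"
  have "\<sigma> > 0"
    using assms by (simp add: \<sigma>_def)
  have \<sigma>: "2 * \<sigma>\<^sup>2 = 1 / c"
    using assms by (simp add: \<sigma>_def)
  have "(\<lambda>t. exp (- c * t\<^sup>2)) = (\<lambda>t. sqrt (pi / c) * normal_density 0 \<sigma> t)"
    using assms by (simp add: normal_density_def mult.assoc \<sigma> fun_eq_iff) (simp add: \<sigma> algebra_simps real_sqrt_divide flip: mult.assoc)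
  then have "integrable lborel (\<lambda>t::real. exp (- c * t\<^sup>2))"
    using \<open>\<sigma> > 0\<close> by simp
  then have fin: "(\<integral>\<^sup>+t. ennreal (exp (- c * t\<^sup>2)) \<partial>lborel) < \<infinity>"
    by (simp add: integrable_iff_bounded)
  have "(\<integral>\<^sup>+x. ennreal (norm (exp (- c * (x \<bullet> x)))) \<partial>(lborel :: 'a measure))
      = (\<integral>\<^sup>+x. (\<Prod>b\<in>Basis. ennreal (exp (- c * (x \<bullet> b)\<^sup>2))) \<partial>(lborel :: 'a measure))"
    by (rule nn_integral_cong)
      (subst euclidean_inner, simp add: prod_ennreal exp_sum sum_distrib_left power2_eq_square sum_negf[symmetric]
        abs_of_nonneg prod_nonneg)
  also have "\<dots> = (\<Prod>b\<in>(Basis::'a set). (\<integral>\<^sup>+t. ennreal (exp (- c * t\<^sup>2)) \<partial>lborel))"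
    by (rule nn_integral_lborel_prod) simp_all
  also have "\<dots> < \<infinity>"
    using fin by (simp add: power_less_top_ennreal)
  finally show "(\<integral>\<^sup>+x. ennreal (norm (exp (- c * (x \<bullet> x)))) \<partial>(lborel :: 'a measure)) < \<infinity>" .
qed simp

lemma continuous_polynomial_function:
  "f \<in> polynomial_functions \<Longrightarrow> continuous_on UNIV f"
  by (intro continuous_at_imp_continuous_on ballI differentiable_imp_continuous_within
      polynomial_function_derivative)

text \<open>
  Bounding by a Gaussian growth with arbitrarily small rate, instead of by a power, suits the induction:
  for a product the rate is divided equally between the factors.
\<close>

lemma polynomial_function_growth:
  fixes f :: "complex ^ 'n::finite \<Rightarrow> complex"
  assumes "f \<in> polynomial_functions" and "e > 0"
  obtains C where "C \<ge> 0" "\<And>z. cmod (f z) \<le> C * exp (e * (z \<bullet> z))"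
proof -
  have ge1: "1 \<le> exp (e * (z \<bullet> z))" if "e > 0" for e :: real and z :: "complex ^ 'n"
    using that by simp
  have "\<exists>C\<ge>0. \<forall>z. cmod (f z) \<le> C * exp (e * (z \<bullet> z))"
    using assms
  proof (induction arbitrary: e)
    case (gen f)
    have "cmod (f z) \<le> (1 + 1 / e) * exp (e * (z \<bullet> z))" for z
    proof -
      \<comment> \<open>The constant \<open>1 + 1 / e\<close> serves because \<open>\<bar>z\<bar> \<le> 1 + \<bar>z\<bar>\<^sup>2\<close> and \<open>1 + e \<bar>z\<bar>\<^sup>2 \<le> exp (e \<bar>z\<bar>\<^sup>2)\<close>.\<close>
      have "cmod (f z) \<le> norm z"
        using gen(1) Finite_Cartesian_Product.norm_nth_le[of z] by auto
      also have "\<dots> \<le> 1 + (norm z)\<^sup>2"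
        using zero_le_power2[of "norm z - 1"] norm_ge_zero[of z] unfolding power2_diff power_one mult_1_right by linarith
      also have "\<dots> \<le> (1 + 1 / e) * (1 + e * (z \<bullet> z))"
        using gen(2) by (simp add: power2_norm_eq_inner distrib_left distrib_right)
      also have "\<dots> \<le> (1 + 1 / e) * exp (e * (z \<bullet> z))"
        using gen(2) by (intro mult_left_mono exp_ge_add_one_self) simp_all
      finally show ?thesis .
    qed
    then show ?case using gen(2) by (intro exI[of _ "1 + 1 / e"]) simp
  next
    case (const c)
    have "cmod c \<le> cmod c * exp (e * (z \<bullet> z))" for z :: "complex ^ 'n"
      using mult_left_mono[OF ge1[OF const, of z] norm_ge_zero[of c]] by simp
    then show ?case by (intro exI[of _ "cmod c"]) simp
  next
    case (add f g)
    then obtain C1 C2 where "C1 \<ge> 0" "C2 \<ge> 0" "\<And>z. cmod (f z) \<le> C1 * exp (e * (z \<bullet> z))"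
      "\<And>z. cmod (g z) \<le> C2 * exp (e * (z \<bullet> z))"
      by meson
    then show ?case
      by (intro exI[of _ "C1 + C2"]) (auto simp: distrib_right intro!: order_trans[OF norm_triangle_ineq] add_mono)
  next
    case (mult f g)
    have "e / 2 > 0" using mult.prems by simp
    with mult.IH obtain C1 C2 where C: "C1 \<ge> 0" "C2 \<ge> 0" "\<And>z. cmod (f z) \<le> C1 * exp (e / 2 * (z \<bullet> z))"
      "\<And>z. cmod (g z) \<le> C2 * exp (e / 2 * (z \<bullet> z))"
      by meson
    have "cmod (f z * g z) \<le> (C1 * C2) * exp (e * (z \<bullet> z))" for z
    proof -
      have "cmod (f z * g z) \<le> (C1 * exp (e / 2 * (z \<bullet> z))) * (C2 * exp (e / 2 * (z \<bullet> z)))"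
        unfolding norm_mult using C by (intro mult_mono) auto
      also have "\<dots> = (C1 * C2) * exp (e / 2 * (z \<bullet> z) + e / 2 * (z \<bullet> z))"
        by (simp only: exp_add mult_ac)
      finally show ?thesis by simp
    qed
    then show ?case using C by (intro exI[of _ "C1 * C2"]) simp
  qed
  then show ?thesis using that by blast
qed

lemma integrable_polynomial_gaussian:
  fixes f :: "complex ^ 'n::finite \<Rightarrow> complex"
  assumes f: "f \<in> polynomial_functions" and c: "c > 0"
  shows "integrable lborel (\<lambda>z. f z * of_real (exp (- c * (z \<bullet> z))))"
proof -
  obtain C where C: "\<And>z. cmod (f z) \<le> C * exp (c / 2 * (z \<bullet> z))"
    using polynomial_function_growth[OF f, of "c / 2"] c by auto
  have [measurable]: "f \<in> borel_measurable borel"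
    by (intro borel_measurable_continuous_onI continuous_polynomial_function f)
  show ?thesis
  proof (rule Bochner_Integration.integrable_bound)
    show "integrable lborel (\<lambda>z :: complex ^ 'n. C * exp (- (c / 2) * (z \<bullet> z)))"
      using c by (intro integrable_mult_right integrable_gaussian) simp
    have "cmod (f z * of_real (exp (- c * (z \<bullet> z)))) \<le> C * exp (- (c / 2) * (z \<bullet> z))" for z
    proof -
      have "cmod (f z * of_real (exp (- c * (z \<bullet> z)))) \<le> C * exp (c / 2 * (z \<bullet> z)) * exp (- c * (z \<bullet> z))"
        unfolding norm_mult using C[of z] by (simp add: mult_right_mono)
      also have "\<dots> = C * exp (c / 2 * (z \<bullet> z) + - c * (z \<bullet> z))"
        by (simp only: exp_add mult.assoc)
      also have "c / 2 * (z \<bullet> z) + - c * (z \<bullet> z) = - (c / 2) * (z \<bullet> z)"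
        by (simp add: field_simps)
      finally show ?thesis .
    qed
    then show "AE z in lborel. cmod (f z * of_real (exp (- c * (z \<bullet> z)))) \<le> norm (C * exp (- (c / 2) * (z \<bullet> z)))"
      by (intro AE_I2) (unfold real_norm_def, rule order_trans[OF _ abs_ge_self])
  qed simp
qed

lemma polynomial_function_inner:
  fixes v :: "complex ^ 'n::finite"
  shows "(\<lambda>z. of_real (z \<bullet> v)) \<in> polynomial_functions"
proof -
  have "(\<lambda>z. complex_of_real (z \<bullet> v)) = (\<lambda>z. \<Sum>j\<in>UNIV. 1 / 2 * (cnj (v $ j) * z $ j + v $ j * cnj (z $ j)))"
  proof
    fix z
    have "complex_of_real (z $ j \<bullet> v $ j) = 1 / 2 * (cnj (v $ j) * z $ j + v $ j * cnj (z $ j))" for j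
      by (rule complex_eqI) (simp_all add: inner_complex_def)
    then show "complex_of_real (z \<bullet> v) = (\<Sum>j\<in>UNIV. 1 / 2 * (cnj (v $ j) * z $ j + v $ j * cnj (z $ j)))"
      by (simp only: inner_vec_def of_real_sum)
  qed
  also have "\<dots> \<in> polynomial_functions"
    by (intro generated_algebra_closure coord_polynomial)
  finally show ?thesis .
qed

text \<open>
  Both the function and its derivative are a polynomial times the Gaussian, hence integrable, so the
  integral of the derivative vanishes.
\<close>

lemma gaussian_integration_by_parts:
  fixes f :: "complex ^ 'n::finite \<Rightarrow> complex"
  assumes f: "f \<in> polynomial_functions" and c: "c > 0"
  shows "(\<integral>z. (dir_deriv f v z - of_real (2 * c * (z \<bullet> v)) * f z) * of_real (exp (- c * (z \<bullet> z))) \<partial>lborel) = 0"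
proof (rule integral_dir_deriv_eq_0)
  let ?D = "\<lambda>z. dir_deriv f v z - of_real (2 * c * (z \<bullet> v)) * f z"
  have D: "?D \<in> polynomial_functions"
    unfolding of_real_mult
    by (intro generated_algebra_closure polynomial_function_derivative polynomial_function_inner f)
  show "integrable lborel (\<lambda>z. f z * of_real (exp (- c * (z \<bullet> z))))"
    by (rule integrable_polynomial_gaussian[OF f c])
  show "integrable lborel (\<lambda>z. ?D z * of_real (exp (- c * (z \<bullet> z))))"
    by (rule integrable_polynomial_gaussian[OF D c])
  show "continuous_on UNIV (\<lambda>z. ?D z * of_real (exp (- c * (z \<bullet> z))))"
    by (intro continuous_intros continuous_polynomial_function[OF D])
  fix z :: "complex ^ 'n"
  have e: "((\<lambda>z. exp (- c * (z \<bullet> z))) has_derivative (\<lambda>v. (- c * (z \<bullet> v + v \<bullet> z)) * exp (- c * (z \<bullet> z)))) (at z)"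
    by (intro has_derivative_exp has_derivative_mult_right has_derivative_inner has_derivative_ident)
  have "(f has_derivative frechet_derivative f (at z)) (at z)"
    using polynomial_function_derivative(1)[OF f] by (simp only: frechet_derivative_works)
  then show "((\<lambda>z. f z * of_real (exp (- c * (z \<bullet> z)))) has_derivative
      (\<lambda>v. f z * of_real ((- c * (z \<bullet> v + v \<bullet> z)) * exp (- c * (z \<bullet> z)))
         + frechet_derivative f (at z) v * of_real (exp (- c * (z \<bullet> z))))) (at z)"
    by (intro has_derivative_mult has_derivative_of_real e)
  show "f z * of_real ((- c * (z \<bullet> v + v \<bullet> z)) * exp (- c * (z \<bullet> z)))
         + frechet_derivative f (at z) v * of_real (exp (- c * (z \<bullet> z)))
      = ?D z * of_real (exp (- c * (z \<bullet> z)))"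
    by (simp add: dir_deriv_def inner_commute[of v z] algebra_simps)
qed

section \<open>Integration by parts against the Ginibre weight\<close>

definition vandermonde_sq :: "complex ^ 'n::{finite,linorder} \<Rightarrow> real" where
  "vandermonde_sq z = (\<Prod>(j,k)\<in>{(j,k). j < k}. (cmod (z $ j - z $ k))\<^sup>2)"

lemma ginibre_weight_eq:
  fixes z :: "complex ^ 'n::{finite,linorder}"
  shows "ginibre_weight z = vandermonde_sq z * exp (- real CARD('n) * (z \<bullet> z))"
  by (simp add: ginibre_weight_def vandermonde_sq_def norm_vec_square)

lemma vandermonde_sq_polynomial:
  "(\<lambda>z :: complex ^ 'n::{finite,linorder}. complex_of_real (vandermonde_sq z)) \<in> polynomial_functions"
  unfolding vandermonde_sq_def of_real_prod case_prod_unfold complex_norm_square complex_cnj_diff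
  by (intro generated_algebra_closure coord_polynomial)

lemma has_derivative_vandermonde_sq:
  fixes z :: "complex ^ 'n::{finite,linorder}"
  shows "(vandermonde_sq has_derivative
    (\<lambda>v. \<Sum>p\<in>{(j,k). j < k}. 2 * ((z $ fst p - z $ snd p) \<bullet> (v $ fst p - v $ snd p))
       * (\<Prod>q\<in>{(j,k). j < k} - {p}. (cmod (z $ fst q - z $ snd q))\<^sup>2))) (at z)"
proof -
  have "((\<lambda>z. (cmod (z $ fst p - z $ snd p))\<^sup>2) has_derivative
      (\<lambda>v. 2 * ((z $ fst p - z $ snd p) \<bullet> (v $ fst p - v $ snd p)))) (at z)" for p :: "'n \<times> 'n"
  proof -
    have d: "((\<lambda>z. z $ fst p - z $ snd p) has_derivative (\<lambda>v. v $ fst p - v $ snd p)) (at z)"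
      by (intro has_derivative_diff has_derivative_coord)
    have "u \<bullet> v + v \<bullet> u = 2 * (u \<bullet> v)" for u v :: complex
      by (simp add: inner_commute)
    with has_derivative_inner[OF d d] show ?thesis
      by (simp add: power2_norm_eq_inner)
  qed
  from has_derivative_prod[OF this] show ?thesis
    by (simp add: vandermonde_sq_def[abs_def] case_prod_unfold)
qed

lemma dir_deriv_vandermonde_sq_vec:
  fixes z :: "complex ^ 'n::{finite,linorder}"
  shows "dir_deriv (\<lambda>z. complex_of_real (vandermonde_sq z)) (vec c) z = 0"
  by (rule trans[OF dir_deriv_eqI[OF has_derivative_of_real[OF has_derivative_vandermonde_sq]]]) simp

text \<open>
  Euler's identity for the homogeneous polynomial \<open>vandermonde_sq\<close> of degree \<open>n (n - 1)\<close>, which depends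
  only on the differences \<open>z\<^sub>j - z\<^sub>k\<close>; the field \<open>centered\<close> scales these at rate \<open>n\<close>.
\<close>

lemma dir_deriv_vandermonde_sq_centered:
  fixes z :: "complex ^ 'n::{finite,linorder}"
  shows "dir_deriv (\<lambda>z. complex_of_real (vandermonde_sq z)) (centered z) z
    = of_nat (CARD('n) * CARD('n) * (CARD('n) - 1)) * of_real (vandermonde_sq z)"
proof -
  let ?P = "{(j,k :: 'n). j < k}"
  have card: "2 * card ?P = CARD('n) * (CARD('n) - 1)"
    using sum_pairs_less[of "\<lambda>(_ :: 'n) (_ :: 'n). 1 :: nat"] by (simp add: case_prod_unfold card_pairs_neq[unfolded case_prod_unfold])
  have "(\<Sum>p\<in>?P. 2 * ((z $ fst p - z $ snd p) \<bullet> (centered z $ fst p - centered z $ snd p))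
       * (\<Prod>q\<in>?P - {p}. (cmod (z $ fst q - z $ snd q))\<^sup>2))
     = (\<Sum>p\<in>?P. 2 * real CARD('n) * vandermonde_sq z)"
  proof (rule sum.cong[OF refl])
    fix p assume p: "p \<in> ?P"
    have "centered z $ fst p - centered z $ snd p = real CARD('n) *\<^sub>R (z $ fst p - z $ snd p)"
      by (simp add: centered_def scaleR_conv_of_real algebra_simps)
    moreover have "vandermonde_sq z = (cmod (z $ fst p - z $ snd p))\<^sup>2 * (\<Prod>q\<in>?P - {p}. (cmod (z $ fst q - z $ snd q))\<^sup>2)"
      unfolding vandermonde_sq_def case_prod_unfold
      by (subst prod.remove[of _ p]) (use p in auto)
    ultimately show "2 * ((z $ fst p - z $ snd p) \<bullet> (centered z $ fst p - centered z $ snd p))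
       * (\<Prod>q\<in>?P - {p}. (cmod (z $ fst q - z $ snd q))\<^sup>2) = 2 * real CARD('n) * vandermonde_sq z"
      by (simp add: power2_norm_eq_inner)
  qed
  also have "\<dots> = real (2 * card ?P) * real CARD('n) * vandermonde_sq z"
    by simp
  also have "\<dots> = real (CARD('n) * CARD('n) * (CARD('n) - 1)) * vandermonde_sq z"
    unfolding card by simp
  finally show ?thesis
    by (simp add: dir_deriv_eqI[OF has_derivative_of_real[OF has_derivative_vandermonde_sq]])
qed

text \<open>
  Left unnormalised, because orthogonality does not see the normalising constant.
\<close>

definition ginibre_integral :: "(complex ^ 'n::{finite,linorder} \<Rightarrow> complex) \<Rightarrow> complex" where
  "ginibre_integral f = (\<integral>z. f z * of_real (ginibre_weight z) \<partial>lborel)"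

lemma integrable_ginibre:
  fixes f :: "complex ^ 'n::{finite,linorder} \<Rightarrow> complex"
  assumes "f \<in> polynomial_functions"
  shows "integrable lborel (\<lambda>z. f z * of_real (ginibre_weight z))"
  using integrable_polynomial_gaussian[OF generated_algebra.mult[OF assms vandermonde_sq_polynomial], of "real CARD('n)"]
  by (simp add: ginibre_weight_eq mult.assoc)

lemma ginibre_integral_add:
  "f \<in> polynomial_functions \<Longrightarrow> g \<in> polynomial_functions \<Longrightarrow>
    ginibre_integral (\<lambda>z. f z + g z) = ginibre_integral f + ginibre_integral g"
  unfolding ginibre_integral_def distrib_right by (intro Bochner_Integration.integral_add integrable_ginibre)

lemma ginibre_integral_diff:
  "f \<in> polynomial_functions \<Longrightarrow> g \<in> polynomial_functions \<Longrightarrow>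
    ginibre_integral (\<lambda>z. f z - g z) = ginibre_integral f - ginibre_integral g"
  unfolding ginibre_integral_def left_diff_distrib by (intro Bochner_Integration.integral_diff integrable_ginibre)

lemma ginibre_integral_cmult: "ginibre_integral (\<lambda>z. c * f z) = c * ginibre_integral f"
  unfolding ginibre_integral_def by (simp add: mult.assoc)

lemma ginibre_integral_cnj: "ginibre_integral (\<lambda>z. cnj (f z)) = cnj (ginibre_integral f)"
  using Bochner_Integration.integral_cnj[of lborel "\<lambda>z. f z * of_real (ginibre_weight z)"]
  unfolding ginibre_integral_def by simp

lemma ginibre_integration_by_parts:
  fixes f :: "complex ^ 'n::{finite,linorder} \<Rightarrow> complex"
  assumes f: "f \<in> polynomial_functions"
  shows "(\<integral>z. (dir_deriv (\<lambda>z. f z * of_real (vandermonde_sq z)) v z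
      - of_real (2 * real CARD('n) * (z \<bullet> v)) * (f z * of_real (vandermonde_sq z))) * of_real (exp (- real CARD('n) * (z \<bullet> z))) \<partial>lborel) = 0"
  by (rule gaussian_integration_by_parts[OF generated_algebra.mult[OF f vandermonde_sq_polynomial]]) simp

text \<open>
  Along a diagonal direction the Vandermonde factor is constant, so only the Gaussian contributes to the
  derivative of the weight.
\<close>

lemma ginibre_translation_identity:
  fixes f :: "complex ^ 'n::{finite,linorder} \<Rightarrow> complex"
  assumes f: "f \<in> polynomial_functions"
  shows "ginibre_integral (dir_deriv f (vec c)) = ginibre_integral (\<lambda>z. of_real (2 * real CARD('n) * (S_poly z \<bullet> c)) * f z)"
proof -
  have 1: "dir_deriv (\<lambda>z. f z * of_real (vandermonde_sq z)) (vec c) z = dir_deriv f (vec c) z * of_real (vandermonde_sq z)" for z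
    using dir_deriv_mult[OF polynomial_function_derivative(1)[OF f] polynomial_function_derivative(1)[OF vandermonde_sq_polynomial], of "vec c" z]
    by (simp add: dir_deriv_vandermonde_sq_vec)
  have 2: "z \<bullet> vec c = S_poly z \<bullet> c" for z :: "(complex, 'n) vec"
    by (simp add: inner_vec_def S_poly_def inner_sum_left)
  have "ginibre_integral (\<lambda>z. dir_deriv f (vec c) z - of_real (2 * real CARD('n) * (z \<bullet> vec c)) * f z) = 0"
    using ginibre_integration_by_parts[OF f, of "vec c"]
    unfolding 1 ginibre_integral_def ginibre_weight_eq of_real_mult
    by (simp add: algebra_simps)
  moreover have "(\<lambda>z. of_real (2 * real CARD('n) * (z \<bullet> vec c)) * f z) \<in> polynomial_functions"
    unfolding of_real_mult by (intro generated_algebra_closure polynomial_function_inner f)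
  ultimately show ?thesis
    by (simp only: ginibre_integral_diff polynomial_function_derivative(2)[OF f] 2 right_minus_eq)
qed

text \<open>
  The divergence theorem for the field \<open>f * centered\<close> against the Ginibre weight. The constant \<open>2 n \<kappa>\<close> is
  the sum of the divergence \<open>2 n (n - 1)\<close> of \<open>centered\<close> and the factor \<open>n\<^sup>2 (n - 1)\<close> from Euler's identity for
  the Vandermonde factor; the term \<open>2 n R\<close> comes from the Gaussian.
\<close>

lemma ginibre_dilation_identity:
  fixes f :: "complex ^ 'n::{finite,linorder} \<Rightarrow> complex"
  assumes f: "f \<in> polynomial_functions"
  shows "ginibre_integral (\<lambda>z. dir_deriv f (centered z) z)
    = ginibre_integral (\<lambda>z. of_real (2 * real CARD('n) * (R_poly z - kappa CARD('n))) * f z)"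
proof -
  let ?n = "real CARD('n)"
  define h where "h = (\<lambda>z. f z * of_real (vandermonde_sq z))"
  have h: "h \<in> polynomial_functions"
    unfolding h_def by (intro generated_algebra.mult f vandermonde_sq_polynomial)
  \<comment> \<open>The components of the field \<open>h * centered\<close> in an orthonormal basis; the partial derivative of each
    component integrates to zero against the Gaussian, and these are summed.\<close>
  define g where "g = (\<lambda>b z. of_real (centered z \<bullet> b) * h z)"
  have coef: "(\<lambda>z. complex_of_real (centered z \<bullet> b)) \<in> polynomial_functions" for b :: "(complex, 'n) vec"
    unfolding centered_inner_commute by (rule polynomial_function_inner)
  have g: "g b \<in> polynomial_functions" for b
    unfolding g_def by (intro generated_algebra.mult coef h)
  have dg: "dir_deriv (g b) b z = of_real (centered z \<bullet> b) * dir_deriv h b z + of_real (centered b \<bullet> b) * h z" for b z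
  proof -
    have "((\<lambda>z. complex_of_real (centered z \<bullet> b)) has_derivative (\<lambda>v. complex_of_real (centered v \<bullet> b))) (at z)"
      unfolding centered_inner_commute by (intro derivative_intros)
    from dir_deriv_eqI[OF this] show ?thesis
      unfolding g_def
      by (subst dir_deriv_mult) (simp_all add: polynomial_function_derivative(1)[OF coef] polynomial_function_derivative(1)[OF h])
  qed
  have dh: "dir_deriv h (centered z) z = (dir_deriv f (centered z) z + of_real (?n * ?n * (?n - 1)) * f z) * of_real (vandermonde_sq z)" for z
  proof -
    have "dir_deriv h (centered z) z = f z * dir_deriv (\<lambda>z. complex_of_real (vandermonde_sq z)) (centered z) z
        + dir_deriv f (centered z) z * of_real (vandermonde_sq z)"
      unfolding h_def
      by (rule dir_deriv_mult) (intro polynomial_function_derivative(1) f vandermonde_sq_polynomial)+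
    then show ?thesis
      by (simp add: dir_deriv_vandermonde_sq_centered of_nat_diff Suc_leI algebra_simps)
  qed
  let ?I = "\<lambda>b z. (dir_deriv (g b) b z - of_real (2 * ?n * (z \<bullet> b)) * g b z) * of_real (exp (- ?n * (z \<bullet> z)))"
  have int: "integrable lborel (?I b)" for b
    unfolding of_real_mult
    by (rule integrable_polynomial_gaussian[unfolded of_real_mult])
      (intro generated_algebra_closure polynomial_function_derivative polynomial_function_inner g, simp)
  have "(\<Sum>b\<in>Basis. ?I b z) = (dir_deriv f (centered z) z
       - of_real (2 * ?n * (R_poly z - kappa CARD('n))) * f z) * of_real (ginibre_weight z)" for z
  proof -
    have "(\<Sum>b\<in>Basis. ?I b z) = ((\<Sum>b\<in>Basis. of_real (centered z \<bullet> b) * dir_deriv h b z)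
        + of_real (\<Sum>b\<in>Basis. centered b \<bullet> (b :: (complex, 'n) vec)) * h z
        - of_real (2 * ?n * (\<Sum>b\<in>Basis. z \<bullet> b * (centered z \<bullet> b))) * h z) * of_real (exp (- ?n * (z \<bullet> z)))"
    proof -
      have "(\<Sum>b\<in>Basis. ?I b z) = (\<Sum>b\<in>Basis. of_real (centered z \<bullet> b) * dir_deriv h b z
          + of_real (centered b \<bullet> b) * h z - of_real (2 * ?n) * (of_real (z \<bullet> b * (centered z \<bullet> b)) * h z))
            * of_real (exp (- ?n * (z \<bullet> z)))"
        unfolding dg sum_distrib_right by (simp add: g_def mult_ac)
      then show ?thesis
        by (simp only: sum_subtractf sum.distrib sum_distrib_left[symmetric] sum_distrib_right[symmetric]
            of_real_sum[symmetric]) simp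
    qed
    also have "(\<Sum>b\<in>Basis. z \<bullet> b * (centered z \<bullet> b)) = R_poly z"
      unfolding euclidean_inner[symmetric] R_poly_eq_centered by (rule inner_commute)
    also have "((\<Sum>b\<in>Basis. of_real (centered z \<bullet> b) * dir_deriv h b z)
        + of_real (\<Sum>b\<in>Basis. centered b \<bullet> (b :: (complex, 'n) vec)) * h z
        - of_real (2 * ?n * R_poly z) * h z)
      = (dir_deriv f (centered z) z
       - of_real (2 * ?n * (R_poly z - kappa CARD('n))) * f z) * of_real (vandermonde_sq z)"
      unfolding sum_Basis_dir_deriv[OF polynomial_function_derivative(1)[OF h]] dh sum_Basis_S_poly
      unfolding h_def kappa_def by (simp add: field_simps)
    finally show ?thesis
      by (simp add: ginibre_weight_eq mult.assoc)
  qed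
  then have "ginibre_integral (\<lambda>z. dir_deriv f (centered z) z - of_real (2 * ?n * (R_poly z - kappa CARD('n))) * f z)
      = (\<integral>z. (\<Sum>b\<in>Basis. ?I b z) \<partial>lborel)"
    unfolding ginibre_integral_def by simp
  also have "\<dots> = (\<Sum>b\<in>Basis. \<integral>z. ?I b z \<partial>lborel)"
    by (rule Bochner_Integration.integral_sum) (rule int)
  also have "\<dots> = 0"
    by (rule sum.neutral) (intro ballI gaussian_integration_by_parts[OF g], simp)
  finally have zero: "ginibre_integral (\<lambda>z. dir_deriv f (centered z) z - of_real (2 * ?n * (R_poly z - kappa CARD('n))) * f z) = 0" .
  have "(\<lambda>z. dir_deriv f (centered z) z) \<in> polynomial_functions"
    unfolding sum_Basis_dir_deriv[OF polynomial_function_derivative(1)[OF f], of "centered _", symmetric]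
    by (intro generated_algebra_sum generated_algebra.mult coef polynomial_function_derivative(2) f)
  moreover have "(\<lambda>z. of_real (2 * ?n * (R_poly z - kappa CARD('n))) * f z) \<in> polynomial_functions"
    unfolding of_real_mult of_real_diff by (intro generated_algebra_closure R_poly_polynomial f)
  ultimately show ?thesis
    using zero by (simp only: ginibre_integral_diff right_minus_eq)
qed

section \<open>Orthogonality\<close>

lemma cnj_hermite_radial: "cnj (hermite_radial a b p z) = hermite_radial b a p z"
  by (simp add: hermite_radial_def cnj_ito ito_commute[of a])

lemma S_poly_hermite_radial:
  "S_poly z * hermite_radial a b p z = hermite_radial (Suc a) b p z + of_nat b * hermite_radial a (b - 1) p z"
  "cnj (S_poly z) * hermite_radial a b p z = hermite_radial a (Suc b) p z + of_nat a * hermite_radial (a - 1) b p z"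
  "of_real (R_poly z) * hermite_radial a b p z = hermite_radial a b (pCons 0 p) z"
  by (simp_all add: hermite_radial_def ito_Suc_right algebra_simps)

text \<open>
  Bilinear instead of sesquilinear, so that index shifts need no conjugation: conjugating
  \<open>hermite_radial a b p\<close> exchanges \<open>a\<close> and \<open>b\<close>.
\<close>

definition pairing ::
  "((complex, 'n::{finite,linorder}) vec \<Rightarrow> complex) \<Rightarrow> ((complex, 'n) vec \<Rightarrow> complex) \<Rightarrow> complex" where
  "pairing f g = ginibre_integral (\<lambda>z. f z * g z)"

lemma pairing_commute: "pairing f g = pairing g f"
  by (simp add: pairing_def mult.commute)

lemma dir_deriv_hermite_radial_mult:
  "dir_deriv (\<lambda>z. hermite_radial a b p z * hermite_radial a' b' q z) v z =
     hermite_radial a b p z * dir_deriv (hermite_radial a' b' q) v z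
     + dir_deriv (hermite_radial a b p) v z * hermite_radial a' b' q z"
  by (intro dir_deriv_mult polynomial_function_derivative(1) hermite_radial_polynomial)

text \<open>
  Combining the translation identities for the directions \<open>1\<close> and \<open>\<i>\<close> gives that integrating \<open>S f\<close> is the
  same as integrating the derivative of \<open>f\<close> with respect to \<open>cnj S\<close>. The term where this derivative falls
  on the first factor is cancelled by the recursion for the first index.
\<close>

lemma pairing_ladder:
  fixes p q :: "real poly"
  shows "pairing (hermite_radial (Suc a) b p :: (complex, 'n::{finite,linorder}) vec \<Rightarrow> complex) (hermite_radial a' b' q)
    = of_nat b' * pairing (hermite_radial a b p :: (complex, 'n) vec \<Rightarrow> complex) (hermite_radial a' (b' - 1) q)"
proof -
  let ?n = "complex_of_nat CARD('n)"
  let ?h = "hermite_radial :: nat \<Rightarrow> nat \<Rightarrow> real poly \<Rightarrow> (complex, 'n) vec \<Rightarrow> complex"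
  define f where "f = (\<lambda>z. ?h a b p z * ?h a' b' q z)"
  define g1 where "g1 = (\<lambda>z. ?h a (b - 1) p z * ?h a' b' q z)"
  define g2 where "g2 = (\<lambda>z. ?h a b p z * ?h a' (b' - 1) q z)"
  have poly: "f \<in> polynomial_functions" "g1 \<in> polynomial_functions" "g2 \<in> polynomial_functions"
    unfolding f_def g1_def g2_def by (intro generated_algebra.mult hermite_radial_polynomial)+
  have D: "dir_deriv f (vec 1) z + \<i> * dir_deriv f (vec \<i>) z = 2 * ?n * (of_nat b * g1 z + of_nat b' * g2 z)" for z
    unfolding f_def dir_deriv_hermite_radial_mult dir_deriv_hermite_radial centered_inner_vec S_poly_vec g1_def g2_def
    by (simp add: algebra_simps)
  have Sf: "2 * ?n * (S_poly z * f z) = of_real (2 * real CARD('n) * (S_poly z \<bullet> 1)) * f z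
      + \<i> * (of_real (2 * real CARD('n) * (S_poly z \<bullet> \<i>)) * f z)" for z
  proof -
    have "S_poly z = of_real (S_poly z \<bullet> 1) + \<i> * of_real (S_poly z \<bullet> \<i>)"
      by (rule complex_eqI) (simp_all add: inner_complex_def)
    then have "2 * ?n * (S_poly z * f z)
        = 2 * ?n * ((of_real (S_poly z \<bullet> 1) + \<i> * of_real (S_poly z \<bullet> \<i>)) * f z)"
      by (rule arg_cong)
    then show ?thesis
      by (simp add: distrib_left distrib_right mult_ac)
  qed
  have A: "(\<lambda>z. of_real (2 * real CARD('n) * (S_poly z \<bullet> c)) * f z) \<in> polynomial_functions" for c
  proof -
    have "(\<lambda>z :: (complex, 'n) vec. complex_of_real (S_poly z \<bullet> c)) = (\<lambda>z. of_real (z \<bullet> vec c))"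
      by (simp add: inner_vec_def S_poly_def inner_sum_left)
    then show ?thesis
      unfolding of_real_mult
      by (intro generated_algebra_closure poly) (simp add: polynomial_function_inner)
  qed
  have "2 * ?n * ginibre_integral (\<lambda>z. S_poly z * f z)
      = ginibre_integral (\<lambda>z. of_real (2 * real CARD('n) * (S_poly z \<bullet> 1)) * f z)
        + \<i> * ginibre_integral (\<lambda>z. of_real (2 * real CARD('n) * (S_poly z \<bullet> \<i>)) * f z)"
    unfolding ginibre_integral_cmult[symmetric] Sf
    by (rule ginibre_integral_add) (intro generated_algebra_cmult A)+
  also have "\<dots> = ginibre_integral (\<lambda>z. dir_deriv f (vec 1) z + \<i> * dir_deriv f (vec \<i>) z)"
    unfolding ginibre_translation_identity[OF poly(1), symmetric] ginibre_integral_cmult[symmetric]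
    by (rule ginibre_integral_add[symmetric]) (intro generated_algebra_cmult polynomial_function_derivative poly)+
  also have "\<dots> = 2 * ?n * ginibre_integral (\<lambda>z. of_nat b * g1 z + of_nat b' * g2 z)"
    unfolding D by (rule ginibre_integral_cmult)
  finally have "ginibre_integral (\<lambda>z. S_poly z * f z) = ginibre_integral (\<lambda>z. of_nat b * g1 z + of_nat b' * g2 z)"
    by simp
  also have "\<dots> = of_nat b * ginibre_integral g1 + of_nat b' * ginibre_integral g2"
    by (simp add: ginibre_integral_add ginibre_integral_cmult generated_algebra_cmult poly)
  also have "(\<lambda>z. S_poly z * f z) = (\<lambda>z. ?h (Suc a) b p z * ?h a' b' q z + of_nat b * g1 z)"
    unfolding f_def g1_def mult.assoc[symmetric] S_poly_hermite_radial by (simp add: algebra_simps)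
  also have "ginibre_integral \<dots> = ginibre_integral (\<lambda>z. ?h (Suc a) b p z * ?h a' b' q z) + of_nat b * ginibre_integral g1"
    by (simp add: ginibre_integral_add ginibre_integral_cmult generated_algebra_cmult poly generated_algebra.mult hermite_radial_polynomial)
  finally show ?thesis
    by (simp add: pairing_def g2_def)
qed

lemma cnj_pairing_hermite_radial:
  "cnj (pairing (hermite_radial a b p :: (complex, 'n::{finite,linorder}) vec \<Rightarrow> complex) (hermite_radial a' b' q))
    = pairing (hermite_radial b a p :: (complex, 'n) vec \<Rightarrow> complex) (hermite_radial b' a' q)"
  by (simp add: pairing_def cnj_hermite_radial flip: ginibre_integral_cnj)

text \<open>
  Each step of the ladder lowers \<open>a\<close> and \<open>a'\<close> together. If \<open>a' = 0\<close> is reached first, the coefficient in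
  the ladder vanishes; the other case is the same after exchanging the factors and conjugating.
\<close>

lemma pairing_eq_0_hermite:
  "a \<noteq> a' \<Longrightarrow> pairing (hermite_radial a b p :: (complex, 'n::{finite,linorder}) vec \<Rightarrow> complex) (hermite_radial b' a' q) = 0"
proof (induction a arbitrary: a')
  case 0
  then obtain A where "a' = Suc A" by (cases a') auto
  then have "cnj (pairing (hermite_radial 0 b p :: (complex, 'n) vec \<Rightarrow> complex) (hermite_radial b' a' q))
      = pairing (hermite_radial (Suc A) b' q :: (complex, 'n) vec \<Rightarrow> complex) (hermite_radial b 0 p)"
    by (simp add: cnj_pairing_hermite_radial) (rule pairing_commute)
  also have "\<dots> = 0"
    by (simp add: pairing_ladder)
  finally show ?case by simp
next
  case (Suc a)
  then show ?case by (cases a') (simp_all add: pairing_ladder)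
qed

text \<open>
  The dilation identity for \<open>h p'(R) h' q(R)\<close>: the field \<open>centered\<close> differentiates only the factors in \<open>R\<close>,
  and the terms without a derivative of \<open>q\<close> form the Laguerre operator applied to \<open>p\<close>.
\<close>

lemma pairing_radial:
  assumes ode: "\<And>x. x * poly (pderiv (pderiv p)) x + (kappa CARD('n) - x) * poly (pderiv p) x = - real m * poly p x"
  shows "of_nat m * pairing (hermite_radial a b p :: (complex, 'n::{finite,linorder}) vec \<Rightarrow> complex) (hermite_radial a' b' q)
    = ginibre_integral (\<lambda>z :: (complex, 'n) vec. of_real (R_poly z) * (hermite_radial a b (pderiv p) z * hermite_radial a' b' (pderiv q) z))"
proof -
  let ?h = "hermite_radial :: nat \<Rightarrow> nat \<Rightarrow> real poly \<Rightarrow> (complex, 'n) vec \<Rightarrow> complex"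
  let ?n = "complex_of_nat CARD('n)"
  \<comment> \<open>Differentiating \<open>p\<close> once in advance makes the second derivative in the Laguerre equation appear.\<close>
  define f where "f = (\<lambda>z. ?h a b (pderiv p) z * ?h a' b' q z)"
  have f: "f \<in> polynomial_functions"
    unfolding f_def by (intro generated_algebra.mult hermite_radial_polynomial)
  define g where "g = (\<lambda>z. of_real (R_poly z) * (?h a b (pderiv p) z * ?h a' b' (pderiv q) z))"
  define g2 where "g2 = (\<lambda>z. of_real (R_poly z) * (?h a b (pderiv (pderiv p)) z * ?h a' b' q z))"
  have poly: "g \<in> polynomial_functions" "g2 \<in> polynomial_functions"
     "(\<lambda>z. of_real (R_poly z - kappa CARD('n)) * f z) \<in> polynomial_functions"
    unfolding g_def g2_def of_real_diff by (intro generated_algebra_closure R_poly_polynomial hermite_radial_polynomial f)+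
  have D: "dir_deriv f (centered z) z = 2 * ?n * (g z + g2 z)" for z
    unfolding f_def dir_deriv_hermite_radial_mult dir_deriv_hermite_radial centered_norm S_poly_centered g_def g2_def
    by (simp add: algebra_simps)
  have "2 * ?n * ginibre_integral (\<lambda>z. g z + g2 z) = 2 * ?n * ginibre_integral (\<lambda>z. of_real (R_poly z - kappa CARD('n)) * f z)"
    using ginibre_dilation_identity[OF f] unfolding D ginibre_integral_cmult[symmetric]
    by (simp add: mult.assoc)
  then have "ginibre_integral g + ginibre_integral g2 = ginibre_integral (\<lambda>z. of_real (R_poly z - kappa CARD('n)) * f z)"
    by (simp add: ginibre_integral_add poly)
  then have "ginibre_integral g = ginibre_integral (\<lambda>z. of_real (R_poly z - kappa CARD('n)) * f z) - ginibre_integral g2"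
    by (simp add: algebra_simps)
  also have "\<dots> = ginibre_integral (\<lambda>z. of_real (R_poly z - kappa CARD('n)) * f z - g2 z)"
    by (rule ginibre_integral_diff[symmetric]) (rule poly)+
  also have "(\<lambda>z. of_real (R_poly z - kappa CARD('n)) * f z - g2 z) = (\<lambda>z. of_nat m * (?h a b p z * ?h a' b' q z))"
  proof
    fix z :: "(complex, 'n) vec"
    define H where "H = ito a b (S_poly z) (cnj (S_poly z)) * ?h a' b' q z"
    have "of_real (R_poly z - kappa CARD('n)) * f z - g2 z
       = - (of_real (R_poly z * poly (pderiv (pderiv p)) (R_poly z) + (kappa CARD('n) - R_poly z) * poly (pderiv p) (R_poly z)) * H)"
      by (simp add: f_def g2_def H_def hermite_radial_def[of a b] algebra_simps)
    also have "\<dots> = of_nat m * (?h a b p z * ?h a' b' q z)"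
      unfolding ode by (simp add: H_def hermite_radial_def[of a b])
    finally show "of_real (R_poly z - kappa CARD('n)) * f z - g2 z = of_nat m * (?h a b p z * ?h a' b' q z)" .
  qed
  also have "ginibre_integral \<dots> = of_nat m * pairing (?h a b p) (?h a' b' q)"
    by (simp add: pairing_def ginibre_integral_cmult)
  finally show ?thesis by (simp add: g_def)
qed

text \<open>
  The right-hand side of \<open>pairing_radial\<close> is symmetric in \<open>p\<close> and \<open>q\<close>, so both eigenvalues multiply the
  pairing to the same result.
\<close>

lemma pairing_eq_0_laguerre:
  assumes "\<And>x. x * poly (pderiv (pderiv p)) x + (kappa CARD('n) - x) * poly (pderiv p) x = - real m * poly p x"
    and "\<And>x. x * poly (pderiv (pderiv q)) x + (kappa CARD('n) - x) * poly (pderiv q) x = - real m' * poly q x"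
    and "m \<noteq> m'"
  shows "pairing (hermite_radial a b p :: (complex, 'n::{finite,linorder}) vec \<Rightarrow> complex) (hermite_radial a' b' q) = 0"
proof -
  have "of_nat m * pairing (hermite_radial a b p :: (complex, 'n) vec \<Rightarrow> complex) (hermite_radial a' b' q)
      = of_nat m' * pairing (hermite_radial a' b' q :: (complex, 'n) vec \<Rightarrow> complex) (hermite_radial a b p)"
    unfolding pairing_radial[OF assms(1)] pairing_radial[OF assms(2)] by (simp add: mult.commute[of "hermite_radial a b _ _"])
  then show ?thesis
    using assms(3) by (simp add: pairing_commute[of "hermite_radial a' b' q"])
qed

section \<open>Non-degeneracy\<close>

lemma continuous_nonneg_integral_0_imp_0:
  fixes f :: "'a::euclidean_space \<Rightarrow> real"
  assumes cont: "continuous_on UNIV f" and nonneg: "\<And>x. 0 \<le> f x"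
    and int: "integrable lborel f" and zero: "(\<integral>x. f x \<partial>lborel) = 0"
  shows "f x = 0"
proof (rule ccontr)
  assume "f x \<noteq> 0"
  have "open {x. f x \<noteq> 0}"
    by (rule open_Collect_neq) (intro cont continuous_on_const)+
  moreover have "AE x in lborel. f x = 0"
    using integral_nonneg_eq_0_iff_AE[OF int] nonneg zero by simp
  then have "{x. f x \<noteq> 0} \<in> null_sets lborel"
    using \<open>open {x. f x \<noteq> 0}\<close> by (subst (asm) AE_iff_null) auto
  then have "negligible {x. f x \<noteq> 0}"
    unfolding negligible_iff_null_sets by (rule null_sets_completionI)
  ultimately show False
    using \<open>f x \<noteq> 0\<close> open_not_negligible by blast
qed

text \<open>
  If the polynomial vanished on \<open>y = cnj x\<close>, so would both of its Wirtinger derivatives, which are multiples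
  of the polynomials with a lowered index; this descends to the constant \<open>ito 0 0 = 1\<close>.
\<close>

lemma ito_nonzero: "\<exists>s. ito a b s (cnj s) \<noteq> 0"
proof (induction "a + b" arbitrary: a b)
  case 0
  then show ?case by simp
next
  case (Suc k)
  show ?case
  proof (rule ccontr)
    assume "\<nexists>s. ito a b s (cnj s) \<noteq> 0"
    then have zero: "(\<lambda>s. ito a b s (cnj s)) = (\<lambda>s. 0)" by auto
    have d: "of_nat a * ito (a - 1) b s (cnj s) * v + of_nat b * ito a (b - 1) s (cnj s) * cnj v = 0" for s v
    proof -
      have "((\<lambda>s. ito a b s (cnj s)) has_derivative
          (\<lambda>v. of_nat a * ito (a - 1) b s (cnj s) * v + of_nat b * ito a (b - 1) s (cnj s) * cnj v)) (at s)"
        by (intro has_derivative_ito has_derivative_cnj has_derivative_ident)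
      moreover have "((\<lambda>s. ito a b s (cnj s)) has_derivative (\<lambda>v. 0)) (at s)"
        unfolding zero by simp
      ultimately show ?thesis
        using has_derivative_unique by metis
    qed
    have "of_nat a * ito (a - 1) b s (cnj s) = 0 \<and> of_nat b * ito a (b - 1) s (cnj s) = 0" for s
    proof -
      define u where "u = of_nat a * ito (a - 1) b s (cnj s)"
      define w where "w = of_nat b * ito a (b - 1) s (cnj s)"
      have "u + w = 0" "\<i> * (u - w) = 0"
        using d[of s 1] d[of s \<i>] by (simp_all add: u_def w_def algebra_simps)
      then have "u = 0 \<and> w = 0"
        by (simp add: eq_neg_iff_add_eq_0[symmetric])
      then show ?thesis by (simp add: u_def w_def)
    qed
    moreover have "a > 0 \<and> k = a - 1 + b \<or> b > 0 \<and> k = a + (b - 1)"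
      using Suc(2) by linarith
    ultimately show False
      using Suc(1)[of "a - 1" b] Suc(1)[of a "b - 1"] by (metis mult_eq_0_iff of_nat_eq_0_iff less_irrefl)
  qed
qed

text \<open>
  Centre any configuration of distinct points, dilate it to the dispersion \<open>r\<close>, and translate it along the
  diagonal to give \<open>S\<close> the value \<open>s\<close>.
\<close>

lemma distinct_point_with_S_R:
  assumes "CARD('n::{finite,linorder}) \<ge> 2" and "r > 0"
  obtains z :: "(complex, 'n::{finite,linorder}) vec" where "z \<in> distinct_points" "S_poly z = s" "R_poly z = r"
proof -
  obtain f :: "'n \<Rightarrow> nat" where f: "inj f"
    using finite_imp_inj_to_nat_seg[of "UNIV :: 'n set"] by auto
  define y0 :: "(complex, 'n) vec" where "y0 = (\<chi> j. of_nat (f j))"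
  have y0: "y0 \<in> distinct_points"
    using f by (auto simp: y0_def distinct_points_def inj_eq)
  define y where "y = centered y0"
  have diff: "y $ j - y $ k = of_nat CARD('n) * (y0 $ j - y0 $ k)" for j k
    by (simp add: y_def centered_def algebra_simps)
  have y: "y $ j \<noteq> y $ k" if "j \<noteq> k" for j k
    using that y0 diff[of j k] by (auto simp: distinct_points_def)
  have "y \<noteq> 0"
  proof
    assume "y = 0"
    then have "j = k" for j k :: 'n
      using y[of j k] by auto
    then have "CARD('n) \<le> 1"
      by (metis card_le_Suc0_iff_eq finite One_nat_def)
    then show False using assms by simp
  qed
  have Sy: "S_poly y = 0"
    by (simp add: y_def)
  have Ry: "R_poly y > 0"
    using \<open>y \<noteq> 0\<close> by (simp add: R_poly_eq_inner Sy)
  define t where "t = sqrt (r / R_poly y)"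
  have t: "t > 0" "t\<^sup>2 * R_poly y = r"
    using Ry assms(2) by (simp_all add: t_def)
  define z where "z = vec (s / of_nat CARD('n)) + t *\<^sub>R y"
  have Sz: "S_poly z = s"
    by (simp add: z_def linear_add[OF linear_S_poly] linear_scale[OF linear_S_poly] Sy)
  have cz: "centered (vec c :: (complex, 'n) vec) = 0" for c
    by (simp add: centered_def vec_eq_iff)
  have "real CARD('n) * R_poly z = real CARD('n) * (t\<^sup>2 * R_poly y)"
    unfolding centered_norm[symmetric]
    by (simp add: z_def linear_add[OF linear_centered] linear_scale[OF linear_centered] cz power2_eq_square
        centered_norm)
  then have "R_poly z = r"
    using t by simp
  moreover have "z \<in> distinct_points"
    using y t by (auto simp: z_def distinct_points_def)
  ultimately show ?thesis using that Sz by blast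
qed

lemma hermite_radial_nonzero:
  assumes "CARD('n::{finite,linorder}) \<ge> 2" and "p \<noteq> 0"
  obtains z :: "(complex, 'n::{finite,linorder}) vec" where "z \<in> distinct_points" "hermite_radial a b p z \<noteq> 0"
proof -
  obtain s where s: "ito a b s (cnj s) \<noteq> 0"
    using ito_nonzero by blast
  have "\<not> {0<..} \<subseteq> {x. poly p x = 0}"
    using poly_roots_finite[OF assms(2)] infinite_Ioi finite_subset by blast
  then obtain r where "r > 0" "poly p r \<noteq> 0" by auto
  obtain z :: "(complex, 'n) vec" where "z \<in> distinct_points" "S_poly z = s" "R_poly z = r"
    by (rule distinct_point_with_S_R[OF assms(1) \<open>r > 0\<close>])
  then show ?thesis
    using that s \<open>poly p r \<noteq> 0\<close> by (simp add: hermite_radial_def)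
qed

lemma ginibre_weight_nonneg: "ginibre_weight z \<ge> 0"
  by (auto simp: ginibre_weight_def intro!: mult_nonneg_nonneg prod_nonneg)

lemma ginibre_weight_pos:
  fixes z :: "complex ^ 'n::{finite,linorder}"
  assumes "z \<in> distinct_points"
  shows "ginibre_weight z > 0"
  unfolding ginibre_weight_def
  using assms by (auto simp: distinct_points_def intro!: mult_pos_pos prod_pos)

lemma continuous_ginibre_weight:
  "continuous_on UNIV (ginibre_weight :: complex ^ 'n::{finite,linorder} \<Rightarrow> real)"
  unfolding ginibre_weight_def case_prod_unfold by (intro continuous_intros)

text \<open>
  The pairing is the integral of a non-negative continuous function that is positive at \<open>z\<close>.
\<close>

lemma pairing_cnj_nonzero:
  assumes f: "f \<in> polynomial_functions" and z: "z \<in> distinct_points" "f z \<noteq> 0"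
  shows "pairing f (\<lambda>z. cnj (f z)) \<noteq> 0"
proof
  assume zero: "pairing f (\<lambda>z. cnj (f z)) = 0"
  let ?g = "\<lambda>z. (cmod (f z))\<^sup>2 * ginibre_weight z"
  have eq: "f z * cnj (f z) * of_real (ginibre_weight z) = complex_of_real (?g z)" for z
    by (simp flip: complex_norm_square)
  have int: "integrable lborel ?g"
    using integrable_ginibre[OF generated_algebra.mult[OF f cnj_polynomial_function[OF f]]]
    unfolding eq by (simp add: complex_of_real_integrable_eq del: of_real_mult of_real_power)
  have "(\<integral>z. ?g z \<partial>lborel) = 0"
    using zero unfolding pairing_def ginibre_integral_def eq by (simp del: of_real_mult of_real_power)
  from continuous_nonneg_integral_0_imp_0[OF _ _ int this, of z]
  have "?g z = 0"
    by (simp add: ginibre_weight_nonneg continuous_intros continuous_polynomial_function[OF f] continuous_ginibre_weight)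
  then show False
    using z ginibre_weight_pos[of z] by simp
qed

section \<open>Basis and orthogonality of the eigenfunctions\<close>

lemma hermite_const_nonzero: "hermite_const a b \<noteq> 0"
  by (simp add: hermite_const_def)

lemma cnj_hermite_const: "cnj (hermite_const a b) = hermite_const a b"
  by (simp add: hermite_const_def)

lemma P_poly_polynomial: "P_poly a b m \<in> polynomial_functions"
  unfolding P_poly_eq_hermite_radial[abs_def]
  by (intro generated_algebra_cmult hermite_radial_polynomial)

text \<open>
  If the Hermite indices differ, the Hermite ladder applies to one of them, after conjugation for \<open>b\<close>;
  otherwise the Laguerre degrees differ.
\<close>

lemma pairing_P_poly_eq_0:
  assumes "CARD('n::{finite,linorder}) \<ge> 2" and "(a, b, m) \<noteq> (a', b', m')"
  shows "pairing (P_poly a b m :: (complex, 'n) vec \<Rightarrow> complex) (\<lambda>z. cnj (P_poly a' b' m' z)) = 0"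
proof -
  let ?h = "hermite_radial :: nat \<Rightarrow> nat \<Rightarrow> real poly \<Rightarrow> (complex, 'n) vec \<Rightarrow> complex"
  let ?L = "\<lambda>m. laguerre m (kappa CARD('n) - 1)"
  have "pairing (P_poly a b m :: (complex, 'n) vec \<Rightarrow> complex) (\<lambda>z. cnj (P_poly a' b' m' z))
      = hermite_const a b * hermite_const a' b' * pairing (?h a b (?L m)) (?h b' a' (?L m'))"
    unfolding pairing_def ginibre_integral_cmult[symmetric]
    by (simp add: P_poly_eq_hermite_radial cnj_hermite_const cnj_hermite_radial mult_ac)
  also have "pairing (?h a b (?L m)) (?h b' a' (?L m')) = 0"
  proof (cases "a = a' \<and> b = b'")
    case True
    then have "m \<noteq> m'" using assms(2) by auto
    then show ?thesis
      by (rule pairing_eq_0_laguerre[OF laguerre_ode(1)[OF assms(1)] laguerre_ode(1)[OF assms(1)]])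
  next
    case False
    then consider "a \<noteq> a'" | "b \<noteq> b'" by auto
    then show ?thesis
    proof cases
      case 1
      then show ?thesis by (rule pairing_eq_0_hermite)
    next
      case 2
      have "pairing (?h a b (?L m)) (?h b' a' (?L m')) = cnj (pairing (?h b a (?L m)) (?h a' b' (?L m')))"
        by (simp add: cnj_pairing_hermite_radial)
      then show ?thesis using pairing_eq_0_hermite[OF 2] by simp
    qed
  qed
  finally show ?thesis by simp
qed

lemma laguerre_nonzero:
  assumes "n \<ge> 2" shows "laguerre m (kappa n - 1) \<noteq> 0"
proof -
  have "is_laguerre m (kappa n - 1) (laguerre m (kappa n - 1))"
    using kappa_pos[OF assms] by (intro is_laguerre_laguerre) simp
  moreover have "(real m + (kappa n - 1)) gchoose m > 0"
    using kappa_pos[OF assms] by (auto simp: gbinomial_prod_rev intro!: divide_pos_pos prod_pos)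
  ultimately show ?thesis
    by (auto simp: is_laguerre_def)
qed

lemma pairing_P_poly_self:
  assumes "CARD('n::{finite,linorder}) \<ge> 2"
  shows "pairing (P_poly a b m :: (complex, 'n) vec \<Rightarrow> complex) (\<lambda>z. cnj (P_poly a b m z)) \<noteq> 0"
proof -
  obtain z :: "(complex, 'n) vec" where "z \<in> distinct_points" "hermite_radial a b (laguerre m (kappa CARD('n) - 1)) z \<noteq> 0"
    using hermite_radial_nonzero[OF assms laguerre_nonzero[OF assms]] by blast
  then show ?thesis
    by (intro pairing_cnj_nonzero[of _ z] P_poly_polynomial) (simp_all add: P_poly_eq_hermite_radial hermite_const_nonzero)
qed

lemma symmetric_polynomials_S_R_P:
  "(S_poly :: complex ^ 'n::finite \<Rightarrow> complex) \<in> symmetric_polynomials"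
  "(\<lambda>z :: complex ^ 'm::{finite,linorder}. complex_of_real (R_poly z)) \<in> symmetric_polynomials"
  "(P_poly a b k :: complex ^ 'm::{finite,linorder} \<Rightarrow> complex) \<in> symmetric_polynomials"
proof -
  have S: "S_poly (\<chi> j. z $ \<sigma> j) = S_poly z" if "bij \<sigma>" for \<sigma> :: "'k::finite \<Rightarrow> 'k" and z :: "complex ^ 'k::finite"
    unfolding S_poly_def vec_lambda_beta using sum.reindex_bij_betw[OF that[unfolded bij_def[symmetric]], of "\<lambda>j. z $ j"] by simp
  have R: "R_poly (\<chi> j. z $ \<sigma> j) = R_poly z" if "bij \<sigma>" for \<sigma> :: "'m::{finite,linorder} \<Rightarrow> 'm" and z :: "complex ^ 'm::{finite,linorder}"
  proof -
    have "(\<chi> j. z $ \<sigma> j) \<bullet> (\<chi> j. z $ \<sigma> j) = z \<bullet> z"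
      unfolding inner_vec_def vec_lambda_beta using sum.reindex_bij_betw[OF that, of "\<lambda>j. z $ j \<bullet> z $ j"] by simp
    then show ?thesis by (simp add: R_poly_eq_inner S[OF that])
  qed
  show "(S_poly :: complex ^ 'n::finite \<Rightarrow> complex) \<in> symmetric_polynomials"
    by (simp add: symmetric_polynomials_def S_poly_polynomial S)
  show "(\<lambda>z :: complex ^ 'm::{finite,linorder}. complex_of_real (R_poly z)) \<in> symmetric_polynomials"
    by (simp add: symmetric_polynomials_def R_poly_polynomial R)
  show "(P_poly a b k :: complex ^ 'm::{finite,linorder} \<Rightarrow> complex) \<in> symmetric_polynomials"
    by (simp add: symmetric_polynomials_def P_poly_polynomial P_poly_def S R)
qed

lemma generator_P_poly:
  fixes z :: "complex ^ 'n::{finite,linorder}"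
  assumes "CARD('n) \<ge> 2" and z: "z \<in> distinct_points"
  shows "generator_poly \<alpha> (P_poly a b m) z
    = - of_real (2 * (\<alpha> / real CARD('n)) * real (a + b + 2 * m)) * P_poly a b m z"
  unfolding P_poly_eq_hermite_radial[abs_def] generator_poly_cmult[OF hermite_radial_polynomial]
    generator_hermite_radial[OF z laguerre_ode(1)[OF assms(1)]]
  by simp

lemma fun_scale_eq: "(\<lambda>z. c * f z) = fun_scale c f"
  by (simp add: fun_scale_def)

lemma fun_space_sum_apply: "(\<Sum>f\<in>F. fun_scale (u f) f) z = (\<Sum>f\<in>F. u f * f z)"
  by (induction F rule: infinite_finite_induct) (simp_all add: fun_scale_def)

lemma inj_P_poly:
  assumes "CARD('n::{finite,linorder}) \<ge> 2"
  shows "inj (\<lambda>(a, b, m). P_poly a b m :: (complex, 'n) vec \<Rightarrow> complex)"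
proof (rule injI)
  fix x y :: "nat \<times> nat \<times> nat"
  obtain a b m a' b' m' where xy: "x = (a, b, m)" "y = (a', b', m')"
    by (cases x, cases y) auto
  assume "(\<lambda>(a, b, m). P_poly a b m :: (complex, 'n) vec \<Rightarrow> complex) x = (\<lambda>(a, b, m). P_poly a b m) y"
  then have "pairing (P_poly a b m :: (complex, 'n) vec \<Rightarrow> complex) (\<lambda>z. cnj (P_poly a' b' m' z)) \<noteq> 0"
    using pairing_P_poly_self[OF assms, of a b m] by (simp add: xy)
  then show "x = y"
    using pairing_P_poly_eq_0[OF assms] xy by blast
qed

lemma P_poly_in_range: "P_poly a b m \<in> range (\<lambda>(a, b, m). P_poly a b m)"
  by (rule range_eqI[of _ _ "(a, b, m)"]) simp

lemma range_P_polyE: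
  assumes "f \<in> range (\<lambda>(a, b, m). P_poly a b m)"
  obtains a b m where "f = P_poly a b m"
  using assms by (elim rangeE) (auto split: prod.splits)

lemma ginibre_integral_sum:
  "(\<And>i. i \<in> A \<Longrightarrow> f i \<in> polynomial_functions) \<Longrightarrow>
    ginibre_integral (\<lambda>z. \<Sum>i\<in>A. f i z) = (\<Sum>i\<in>A. ginibre_integral (f i))"
  unfolding ginibre_integral_def sum_distrib_right
  by (intro Bochner_Integration.integral_sum integrable_ginibre)

text \<open>
  Pairing a linear relation with the conjugate of a member \<open>g\<close> isolates the coefficient of \<open>g\<close>.
\<close>

lemma independent_P_poly:
  assumes "CARD('n::{finite,linorder}) \<ge> 2"
  shows "fun_space.independent (range (\<lambda>(a, b, m). P_poly a b m :: (complex, 'n) vec \<Rightarrow> complex))"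
    (is "fun_space.independent ?B")
proof
  assume dep: "fun_space.dependent ?B"
  obtain T u g where T: "finite T" "T \<subseteq> ?B" and sum: "(\<Sum>f\<in>T. fun_scale (u f) f) = 0"
    and g: "g \<in> T" "u g \<noteq> 0"
    using fun_space.dependent_explicit[THEN iffD1, OF dep] by (elim exE conjE bexE) (rule that)
  have poly: "f \<in> polynomial_functions" if "f \<in> T" for f
    using subsetD[OF T(2) that] P_poly_polynomial by (elim range_P_polyE) simp
  have orth: "pairing f (\<lambda>z. cnj (g z)) = 0" if "f \<in> T - {g}" for f
  proof -
    from that have "f \<in> ?B" using T(2) by blast
    then obtain a b m where 1: "f = P_poly a b m" by (rule range_P_polyE)
    from g(1) have "g \<in> ?B" using T(2) by blast
    then obtain a' b' m' where 2: "g = P_poly a' b' m'" by (rule range_P_polyE)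
    note f = 1 2
    then have "(a, b, m) \<noteq> (a', b', m')" using that by auto
    then show ?thesis unfolding f by (rule pairing_P_poly_eq_0[OF assms])
  qed
  have "0 = ginibre_integral (\<lambda>z. (\<Sum>f\<in>T. fun_scale (u f) f) z * cnj (g z))"
    unfolding sum by (simp add: ginibre_integral_def)
  also have "\<dots> = (\<Sum>f\<in>T. u f * pairing f (\<lambda>z. cnj (g z)))"
    unfolding fun_space_sum_apply sum_distrib_right mult.assoc pairing_def ginibre_integral_cmult[symmetric]
    by (rule ginibre_integral_sum)
      (intro generated_algebra_cmult generated_algebra.mult poly cnj_polynomial_function g(1))
  also have "\<dots> = u g * pairing g (\<lambda>z. cnj (g z))"
    using T(1) g(1) by (subst sum.remove[of _ g]) (simp_all add: orth)
  finally have "pairing g (\<lambda>z. cnj (g z)) = 0"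
    using g(2) by simp
  moreover obtain a b m where "g = P_poly a b m"
    using subsetD[OF T(2) g(1)] by (rule range_P_polyE)
  ultimately show False
    using pairing_P_poly_self[OF assms] by simp
qed

lemma P_poly_in_SR_algebra:
  "P_poly a b m \<in> SR_algebra"
proof -
  have "hermite_radial a b p \<in> SR_algebra" for p
    unfolding SR_algebra_def hermite_radial_def[abs_def]
    by (intro generated_algebra.mult generated_algebra_ito generated_algebra_poly generated_algebra.gen) auto
  then show ?thesis
    unfolding P_poly_eq_hermite_radial[abs_def] SR_algebra_def by (intro generated_algebra_cmult)
qed

lemma subspace_SR_algebra: "fun_space.subspace SR_algebra"
proof (rule fun_space.subspaceI)
  show "0 \<in> SR_algebra"
    unfolding SR_algebra_def zero_fun_def by (rule generated_algebra.const)
  show "f + g \<in> SR_algebra" if "f \<in> SR_algebra" "g \<in> SR_algebra" for f g :: "(complex, 'a) vec \<Rightarrow> complex"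
    using that unfolding SR_algebra_def plus_fun_def by (rule generated_algebra.add)
  show "fun_scale c f \<in> SR_algebra" if "f \<in> SR_algebra" for c and f :: "(complex, 'a) vec \<Rightarrow> complex"
    using that unfolding SR_algebra_def fun_scale_def by (rule generated_algebra_cmult)
qed

text \<open>
  Laguerre polynomials of all degrees form a triangular basis of the polynomials in one variable:
  subtracting a multiple of the one with degree \<open>degree p\<close> lowers the degree of \<open>p\<close>.
\<close>

lemma hermite_radial_in_span:
  assumes "CARD('n::{finite,linorder}) \<ge> 2"
  shows "(hermite_radial a b p :: (complex, 'n) vec \<Rightarrow> complex) \<in> fun_space.span (range (\<lambda>(a, b, m). P_poly a b m))"
    (is "_ \<in> ?W")
proof (induction "degree p" arbitrary: p rule: less_induct)
  case less
  show ?case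
  proof (cases "p = 0")
    case True
    then have "hermite_radial a b p = (0 :: (complex, 'n) vec \<Rightarrow> complex)"
      by (simp add: hermite_radial_def[abs_def] zero_fun_def)
    then show ?thesis by (simp add: fun_space.span_zero)
  next
    case False
    define m where "m = degree p"
    define L where "L = laguerre m (kappa CARD('n) - 1)"
    have L: "degree L = m" "L \<noteq> 0"
      unfolding L_def by (rule laguerre_ode laguerre_nonzero assms)+
    define c where "c = lead_coeff p / lead_coeff L"
    define r where "r = p - smult c L"
    have "degree r \<le> m"
      unfolding r_def using L by (intro degree_diff_le) (auto simp: m_def)
    moreover have "coeff L m \<noteq> 0"
      using L leading_coeff_0_iff by metis
    then have "coeff r m = 0"
      using L(1) by (simp add: r_def c_def m_def)
    ultimately have r: "r = 0 \<or> degree r < m"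
      by (metis eq_zero_or_degree_less)
    have "(hermite_radial a b r :: (complex, 'n) vec \<Rightarrow> complex) \<in> ?W"
    proof (cases "r = 0")
      case True
      then have "hermite_radial a b r = (0 :: (complex, 'n) vec \<Rightarrow> complex)"
        by (simp add: hermite_radial_def[abs_def] zero_fun_def)
      then show ?thesis by (simp add: fun_space.span_zero)
    next
      case False
      then show ?thesis using r less.hyps[of r] by (simp add: m_def)
    qed
    moreover have "(P_poly a b m :: (complex, 'n) vec \<Rightarrow> complex) \<in> ?W"
      by (rule fun_space.span_base) (rule P_poly_in_range)
    moreover have "hermite_radial a b p = hermite_radial a b r
        + fun_scale (of_real c / hermite_const a b) (P_poly a b m :: (complex, 'n) vec \<Rightarrow> complex)"
    proof
      fix z :: "(complex, 'n) vec"
      have "poly p x = poly r x + c * poly L x" for x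
        by (simp add: r_def)
      then show "hermite_radial a b p z = (hermite_radial a b r + fun_scale (of_real c / hermite_const a b) (P_poly a b m)) z"
        by (simp add: fun_scale_def P_poly_eq_hermite_radial hermite_const_nonzero L_def[symmetric])
          (simp add: hermite_radial_def algebra_simps)
    qed
    ultimately show ?thesis
      by (simp add: fun_space.span_add fun_space.span_scale)
  qed
qed

text \<open>
  The span contains \<open>1\<close> and is stable under multiplication by the three generators of the algebra, by
  \<open>S_poly_hermite_radial\<close>; hence it is stable under multiplication by the whole algebra and contains it.
\<close>

lemma span_P_poly:
  assumes "CARD('n::{finite,linorder}) \<ge> 2"
  shows "fun_space.span (range (\<lambda>(a, b, m). P_poly a b m :: (complex, 'n) vec \<Rightarrow> complex)) = SR_algebra"
    (is "fun_space.span ?B = _")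
proof
  show "fun_space.span ?B \<subseteq> SR_algebra"
    by (rule fun_space.span_minimal[OF _ subspace_SR_algebra]) (auto simp: P_poly_in_SR_algebra)
  have mult_closed: "(\<lambda>z. x z * g z) \<in> fun_space.span ?B"
    if "g \<in> fun_space.span ?B" and "\<And>a b p. (\<lambda>z. x z * hermite_radial a b p z) \<in> fun_space.span ?B" for x g
    using that(1)
  proof (induction rule: fun_space.span_induct)
    show "fun_space.subspace {g. (\<lambda>z. x z * g z) \<in> fun_space.span ?B}"
    proof (rule fun_space.subspaceI; clarsimp)
      show "(\<lambda>z. 0) \<in> fun_space.span ?B"
        using fun_space.span_zero by (simp add: zero_fun_def)
      show "(\<lambda>z. x z * (f z + g z)) \<in> fun_space.span ?B"
        if "(\<lambda>z. x z * f z) \<in> fun_space.span ?B" "(\<lambda>z. x z * g z) \<in> fun_space.span ?B" for f g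
        using fun_space.span_add[OF that] by (simp add: plus_fun_def distrib_left)
      show "(\<lambda>z. x z * fun_scale c f z) \<in> fun_space.span ?B"
        if "(\<lambda>z. x z * f z) \<in> fun_space.span ?B" for c f
        using fun_space.span_scale[OF that, of c] by (simp add: fun_scale_def mult.left_commute)
    qed
    fix g assume "g \<in> ?B"
    then obtain a b m where g: "g = P_poly a b m" by (rule range_P_polyE)
    show "(\<lambda>z. x z * g z) \<in> fun_space.span ?B"
      using fun_space.span_scale[OF that(2), of "hermite_const a b" a b]
      by (simp add: g P_poly_eq_hermite_radial fun_scale_def mult.left_commute)
  qed
  note H = hermite_radial_in_span[OF assms]
  have comb: "(\<lambda>z. hermite_radial a b p z + c * hermite_radial a' b' q z) \<in> fun_space.span ?B" for a b p c a' b' q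
    using fun_space.span_add[OF H fun_space.span_scale[OF H]] by (simp add: plus_fun_def fun_scale_def)
  have "\<forall>g \<in> fun_space.span ?B. (\<lambda>z. f z * g z) \<in> fun_space.span ?B" if "f \<in> SR_algebra" for f
    using that unfolding SR_algebra_def
  proof induction
    case (gen f)
    have "(\<lambda>z. f z * hermite_radial a b p z) \<in> fun_space.span ?B" for a b p
      using gen by (elim insertE emptyE) (simp_all add: S_poly_hermite_radial comb H)
    then show ?case using mult_closed by blast
  next
    case (const c)
    show ?case
    proof
      fix g assume "g \<in> fun_space.span ?B"
      then show "(\<lambda>z. c * g z) \<in> fun_space.span ?B"
        unfolding fun_scale_eq[of c g] by (rule fun_space.span_scale)
    qed
  next
    case (add f g)
    show ?case
    proof
      fix h assume "h \<in> fun_space.span ?B"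
      with add.IH have "(\<lambda>z. f z * h z) \<in> fun_space.span ?B" "(\<lambda>z. g z * h z) \<in> fun_space.span ?B" by auto
      from fun_space.span_add[OF this] show "(\<lambda>z. (f z + g z) * h z) \<in> fun_space.span ?B"
        by (simp add: plus_fun_def distrib_right)
    qed
  next
    case (mult f g)
    show ?case
    proof
      fix h assume h: "h \<in> fun_space.span ?B"
      from bspec[OF mult.IH(1) bspec[OF mult.IH(2) h]] show "(\<lambda>z. (f z * g z) * h z) \<in> fun_space.span ?B"
        by (simp add: mult.assoc)
    qed
  qed
  moreover have "(\<lambda>z. 1) \<in> fun_space.span ?B"
    using H[of 0 0 1] by (simp add: hermite_radial_def[abs_def])
  ultimately show "SR_algebra \<subseteq> fun_space.span ?B"
    by fastforce
qed

text \<open>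
  The polynomial functions that the generator maps into the algebra form a subspace. It contains the
  eigenfunctions \<open>P_poly a b m\<close>, hence their span.
\<close>

lemma SR_algebra_generator_invariant:
  assumes "CARD('n::{finite,linorder}) \<ge> 2" and "f \<in> SR_algebra"
  shows "\<exists>g \<in> SR_algebra. \<forall>z \<in> (distinct_points :: (complex, 'n) vec set). generator \<alpha> f z = g z"
proof -
  let ?V = "{f \<in> polynomial_functions. \<exists>g \<in> SR_algebra. \<forall>z \<in> (distinct_points :: (complex, 'n) vec set). generator_poly \<alpha> f z = g z}"
  have "f \<in> fun_space.span (range (\<lambda>(a, b, m). P_poly a b m :: (complex, 'n) vec \<Rightarrow> complex))"
    using assms by (simp add: span_P_poly)
  also have "\<dots> \<subseteq> ?V"
  proof (rule fun_space.span_minimal)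
    show "range (\<lambda>(a, b, m). P_poly a b m) \<subseteq> ?V"
    proof
      fix f :: "(complex, 'n) vec \<Rightarrow> complex" assume "f \<in> range (\<lambda>(a, b, m). P_poly a b m)"
      then obtain a b m where f: "f = P_poly a b m" by (rule range_P_polyE)
      let ?c = "- complex_of_real (2 * (\<alpha> / real CARD('n)) * real (a + b + 2 * m))"
      have "(\<lambda>z :: (complex, 'n) vec. ?c * P_poly a b m z) \<in> SR_algebra"
        using P_poly_in_SR_algebra unfolding SR_algebra_def by (rule generated_algebra_cmult)
      then show "f \<in> ?V"
        unfolding f
        by (intro CollectI conjI bexI[of _ "\<lambda>z. ?c * P_poly a b m z"] ballI P_poly_polynomial
            generator_P_poly[OF assms(1)])
    qed
    show "fun_space.subspace ?V"
    proof (rule fun_space.subspaceI)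
      have "generator_poly \<alpha> (\<lambda>z :: (complex, 'n) vec. 0 * 0) z = 0 * generator_poly \<alpha> (\<lambda>z. 0) z" for z
        by (rule generator_poly_cmult) (rule generated_algebra.const)
      then show "0 \<in> ?V"
        by (auto simp: zero_fun_def SR_algebra_def intro!: generated_algebra.const bexI[of _ "\<lambda>z. 0"])
    next
      fix f g assume "f \<in> ?V" "g \<in> ?V"
      then obtain f' g' where poly: "f \<in> polynomial_functions" "g \<in> polynomial_functions"
        and SR: "f' \<in> SR_algebra" "g' \<in> SR_algebra"
        and gen: "\<And>z. z \<in> distinct_points \<Longrightarrow> generator_poly \<alpha> f z = f' z"
          "\<And>z. z \<in> distinct_points \<Longrightarrow> generator_poly \<alpha> g z = g' z"
        by blast
      have "(\<lambda>z. f' z + g' z) \<in> SR_algebra"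
        using SR unfolding SR_algebra_def by (rule generated_algebra.add)
      then show "f + g \<in> ?V"
        using poly gen by (auto simp: plus_fun_def generated_algebra.add generator_poly_add intro!: bexI[of _ "\<lambda>z. f' z + g' z"])
    next
      fix c f assume "f \<in> ?V"
      then obtain f' where poly: "f \<in> polynomial_functions" and SR: "f' \<in> SR_algebra"
        and gen: "\<And>z. z \<in> distinct_points \<Longrightarrow> generator_poly \<alpha> f z = f' z"
        by blast
      have "(\<lambda>z. c * f' z) \<in> SR_algebra"
        using SR unfolding SR_algebra_def by (rule generated_algebra_cmult)
      then show "fun_scale c f \<in> ?V"
        using poly gen by (auto simp: fun_scale_def generated_algebra_cmult generator_poly_cmult intro!: bexI[of _ "\<lambda>z. c * f' z"])
    qed
  qed
  finally show ?thesis
    by (auto simp: generator_eq_generator_poly)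
qed

lemma borel_measurable_ginibre_weight [measurable]:
  "(ginibre_weight :: complex ^ 'n::{finite,linorder} \<Rightarrow> real) \<in> borel_measurable borel"
  by (rule borel_measurable_continuous_onI[OF continuous_ginibre_weight])

lemma borel_measurable_polynomial_function:
  "f \<in> polynomial_functions \<Longrightarrow> f \<in> borel_measurable borel"
  by (intro borel_measurable_continuous_onI continuous_polynomial_function)

lemma square_integrable_polynomial:
  fixes f :: "complex ^ 'n::{finite,linorder} \<Rightarrow> complex"
  assumes f: "f \<in> polynomial_functions"
  shows "square_integrable ginibre_measure f"
proof -
  note [measurable] = borel_measurable_polynomial_function[OF f]
  define Z where "Z = (LINT w|lborel. ginibre_weight (w :: (complex, 'n) vec))"
  have Z: "Z \<ge> 0"
    unfolding Z_def by (rule integral_nonneg_AE) (simp add: ginibre_weight_nonneg)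
  have "integrable lborel (\<lambda>z. f z * cnj (f z) * of_real (ginibre_weight z))"
    by (intro integrable_ginibre generated_algebra.mult f cnj_polynomial_function)
  from integrable_Re[OF this] have "integrable lborel (\<lambda>z. ginibre_weight z * (cmod (f z))\<^sup>2)"
    by (simp add: mult.commute flip: complex_norm_square of_real_power)
  then have "integrable lborel (\<lambda>z. ginibre_weight z * (cmod (f z))\<^sup>2 / Z)"
    by (rule integrable_divide)
  then have "integrable lborel (\<lambda>z. ginibre_weight z / Z * (cmod (f z))\<^sup>2)"
    by simp
  then show ?thesis
    unfolding square_integrable_def ginibre_measure_def Z_def[symmetric]
    by (subst integrable_density) (simp_all add: Z ginibre_weight_nonneg)
qed

lemma L2_inner_ginibre:
  fixes f g :: "complex ^ 'n::{finite,linorder} \<Rightarrow> complex"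
  assumes f: "f \<in> polynomial_functions" and g: "g \<in> polynomial_functions"
  shows "L2_inner ginibre_measure f g
    = pairing f (\<lambda>z. cnj (g z)) / of_real (LINT w|lborel. ginibre_weight (w :: (complex, 'n) vec))"
proof -
  note [measurable] = borel_measurable_polynomial_function[OF f] borel_measurable_polynomial_function[OF g]
  define Z where "Z = (LINT w|lborel. ginibre_weight (w :: (complex, 'n) vec))"
  have Z: "Z \<ge> 0"
    unfolding Z_def by (rule integral_nonneg_AE) (simp add: ginibre_weight_nonneg)
  have "L2_inner ginibre_measure f g = (\<integral>z. (ginibre_weight z / Z) *\<^sub>R (f z * cnj (g z)) \<partial>lborel)"
    unfolding L2_inner_def ginibre_measure_def Z_def[symmetric]
    by (subst integral_density)
      (simp_all add: Z ginibre_weight_nonneg borel_measurable_polynomial_function generated_algebra.mult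
        cnj_polynomial_function f g)
  also have "\<dots> = (\<integral>z. f z * cnj (g z) * of_real (ginibre_weight z) / of_real Z \<partial>lborel)"
    by (simp add: scaleR_conv_of_real mult_ac)
  finally show ?thesis
    unfolding Z_def[symmetric] pairing_def ginibre_integral_def by simp
qed

theorem theorem1p4:
  fixes \<alpha> :: real and n :: nat
  assumes "n = CARD('n::{finite,linorder})" and "n \<ge> 2" and "\<alpha> > 0"
  shows
    "(S_poly :: (complex, 'n) vec \<Rightarrow> complex) \<in> symmetric_polynomials \<and>
     (\<lambda>z :: (complex, 'n) vec. complex_of_real (R_poly z)) \<in> symmetric_polynomials \<and>
     (\<forall>z :: (complex, 'n) vec.
        R_poly z = real n * (\<Sum>j\<in>UNIV. (cmod (z $ j - S_poly z / of_nat n))\<^sup>2)) \<and>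
     (\<forall>a b m. (P_poly a b m :: (complex, 'n) vec \<Rightarrow> complex) \<in> symmetric_polynomials) \<and>
     (\<forall>a b m. \<forall>z \<in> (distinct_points :: (complex, 'n) vec set).
        - generator \<alpha> (P_poly a b m) z
          = complex_of_real (2 * (\<alpha> / real n) * real (a + b + 2 * m)) * P_poly a b m z) \<and>
     inj (\<lambda>(a, b, m). P_poly a b m :: (complex, 'n) vec \<Rightarrow> complex) \<and>
     fun_space.independent
       (range (\<lambda>(a, b, m). P_poly a b m :: (complex, 'n) vec \<Rightarrow> complex)) \<and>
     fun_space.span
       (range (\<lambda>(a, b, m). P_poly a b m :: (complex, 'n) vec \<Rightarrow> complex)) = SR_algebra \<and>
     (\<forall>f \<in> (SR_algebra :: ((complex, 'n) vec \<Rightarrow> complex) set). \<exists>g \<in> SR_algebra.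
        \<forall>z \<in> distinct_points. generator \<alpha> f z = g z) \<and>
     (\<forall>a b m. square_integrable ginibre_measure
        (P_poly a b m :: (complex, 'n) vec \<Rightarrow> complex)) \<and>
     (\<forall>a b m a' b' m'. (a, b, m) \<noteq> (a', b', m') \<longrightarrow>
        L2_inner ginibre_measure
          (P_poly a b m :: (complex, 'n) vec \<Rightarrow> complex) (P_poly a' b' m') = 0)"
proof -
  have n: "CARD('n) \<ge> 2" using assms by simp
  show ?thesis
    unfolding assms(1)
  proof (intro conjI allI ballI impI)
    fix a b m and z :: "(complex, 'n) vec"
    assume z: "z \<in> distinct_points"
    show "- generator \<alpha> (P_poly a b m) z
          = complex_of_real (2 * (\<alpha> / real CARD('n)) * real (a + b + 2 * m)) * P_poly a b m z"
      by (simp only: generator_eq_generator_poly[OF P_poly_polynomial z] generator_P_poly[OF n z] mult_minus_left minus_minus)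
  next
    fix a b m a' b' m' :: nat
    assume "(a, b, m) \<noteq> (a', b', m')"
    then show "L2_inner ginibre_measure (P_poly a b m :: (complex, 'n) vec \<Rightarrow> complex) (P_poly a' b' m') = 0"
      by (simp add: L2_inner_ginibre P_poly_polynomial pairing_P_poly_eq_0[OF n])
  qed (simp_all only: symmetric_polynomials_S_R_P R_poly_centered_sum[symmetric] inj_P_poly[OF n]
      independent_P_poly[OF n] span_P_poly[OF n] SR_algebra_generator_invariant[OF n]
      square_integrable_polynomial P_poly_polynomial not_False_eq_True)
qed

end
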